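(* Let $\nu\in\mathbb{R}^k$ be such that $A(\nu)$ is stable, let $f(\nu)=\mathrm{trace}(Y(\nu))$, where $Y(\nu)$ is the solution of $A(\nu)Y(\nu)+Y(\nu)A(\nu)^T=-Z$, and let $W(\nu)$ be the solution of $A(\nu)^TW(\nu)+W(\nu)A(\nu)=-I_{2n}$. Then the gradient and the Hessian of $f$ at $\nu$ are $$\nabla f(\nu)=-\mathcal{U}(Y(\nu),W(\nu)),$$ $$\nabla^2f(\nu)=-\left(\mathcal{M}(\nu)\mathcal{P}(\nu)^{-T}\mathcal{N}(\nu)^T+\mathcal{N}(\nu)\mathcal{P}(\nu)^{-1}\mathcal{M}(\nu)^T\right),$$ where $\mathcal{P}(\nu)=I_{2n}\otimes A(\nu)+A(\nu)\otimes I_{2n}$, the map $\mathcal{U}:\mathbb{R}^{2n\times 2n}\times\mathbb{R}^{2n\times 2n}\to\mathbb{R}^k$ is such that $$e_i^T\mathcal{U}(Y(\nu),W(\nu))=\mathrm{trace}\left(W(\nu)^T\left(U_iU_i^TY(\nu)+Y(\nu)U_iU_i^T\right)\right),\quad i=1,\dots,k,$$ and $\mathcal{M}(\nu),\mathcal{N}(\nu)\in\mathbb{R}^{k\times 4n^2}$ are the matrices with rows $$e_i^T\mathcal{M}(\nu)=\mathrm{vec}\left(U_iU_i^TY(\nu)+Y(\nu)U_iU_i^T\right)^T,\qquad e_i^T\mathcal{N}(\nu)=\mathrm{vec}\left(W(\nu)U_iU_i^T+U_iU_i^TW(\nu)\right)^T,\quad i=1,\dots,k.$$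
   Context: $M,K\in\mathbb{R}^{n\times n}$ are symmetric positive definite, $D_{\mathrm{int}}\in\mathbb{R}^{n\times n}$ is symmetric positive semidefinite with $D_{\mathrm{int}}M^{-1}K=KM^{-1}D_{\mathrm{int}}$, and $D(\nu)=D_{\mathrm{int}}+\sum_{i=1}^k\nu_iD_iD_i^T$ with $D_i\in\mathbb{R}^{n\times r_i}$ given full rank matrices. $\Phi\in\mathbb{R}^{n\times n}$ is a nonsingular matrix with $\Phi^TM\Phi=I_n$, $\Phi^TK\Phi=\Omega^2$, $\Omega=\mathrm{diag}(\omega_1,\dots,\omega_n)$ with all $\omega_i>0$, and $\Phi^TD_{\mathrm{int}}\Phi=\Gamma$ diagonal. Define $$A(\nu)=\begin{bmatrix}0&\Omega\\-\Omega&-\Phi^TD(\nu)\Phi\end{bmatrix}\in\mathbb{R}^{2n\times 2n},\qquad U_i=\begin{bmatrix}0\\ \Phi^TD_i\end{bmatrix}\in\mathbb{R}^{2n\times r_i},$$ so that $A(\nu)=A(0)-\sum_{i=1}^k\nu_iU_iU_i^T$. For a given integer $s$ with $1\le s\le n$, $Z=\frac{1}{2s}GG^T$, where $$G=\begin{bmatrix}I_s&0\\0&0\\0&I_s\\0&0\end{bmatrix}\in\mathbb{R}^{2n\times 2s}$$ (block rows of sizes $s,n-s,s,n-s$). A matrix is called stable if all its eigenvalues have strictly negative real part; when $A(\nu)$ is stable, the Lyapunov equations $A(\nu)Y+YA(\nu)^T=-Z$ and $A(\nu)^TW+WA(\nu)=-I_{2n}$ each have a unique solution. $\otimes$ is the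 Kronecker product, $\mathrm{vec}$ stacks the columns of a matrix into one long vector, $e_i$ is the $i$th standard unit vector of $\mathbb{R}^k$, and $\mathcal{P}^{-T}=(\mathcal{P}^{-1})^T$. *)

theory Defs
  imports
    "HOL-Analysis.Analysis"
    "Jordan_Normal_Form.Char_Poly"
    "Jordan_Normal_Form.DL_Rank"
    "Jordan_Normal_Form.Gauss_Jordan_Elimination"
begin

text \<open>
  Matrices whose sizes depend on the natural numbers \<open>n\<close>, \<open>s\<close>, \<open>r i\<close> are \<open>Matrix.mat\<close>;
  the parameter space, on which we differentiate, is \<^typ>\<open>real ^ 'k\<close>.
  From here on \<open>$\<close> is only the component of a \<^typ>\<open>real ^ 'k\<close>.
\<close>

no_notation vec_index (infixl "$" 100)

definition pos_semidef :: "real mat \<Rightarrow> bool" where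
  "pos_semidef A \<longleftrightarrow> square_mat A \<and> A\<^sup>T = A \<and>
     (\<forall>x \<in> carrier_vec (dim_row A). 0 \<le> scalar_prod x (A *\<^sub>v x))"

definition pos_def :: "real mat \<Rightarrow> bool" where
  "pos_def A \<longleftrightarrow> square_mat A \<and> A\<^sup>T = A \<and>
     (\<forall>x \<in> carrier_vec (dim_row A). x \<noteq> 0\<^sub>v (dim_row A) \<longrightarrow> 0 < scalar_prod x (A *\<^sub>v x))"

definition full_rank :: "real mat \<Rightarrow> bool" where
  "full_rank A \<longleftrightarrow> vec_space.rank (dim_row A) A = min (dim_row A) (dim_col A)"

definition stable :: "real mat \<Rightarrow> bool" where
  "stable A \<longleftrightarrow> (\<forall>z. eigenvalue (map_mat complex_of_real A) z \<longrightarrow> Re z < 0)"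

definition trace :: "real mat \<Rightarrow> real" where
  "trace A = (\<Sum>i<dim_row A. A $$ (i, i))"

text \<open>Only meaningful for invertible matrices.\<close>

definition minv :: "real mat \<Rightarrow> real mat" where
  "minv A = the (mat_inverse A)"

definition mat_sum :: "nat \<Rightarrow> nat \<Rightarrow> ('k::finite \<Rightarrow> real mat) \<Rightarrow> real mat" where
  "mat_sum m n F = Matrix.mat m n (\<lambda>(a, b). \<Sum>i\<in>UNIV. F i $$ (a, b))"

definition kronecker :: "real mat \<Rightarrow> real mat \<Rightarrow> real mat" (infixl "\<otimes>\<^sub>K" 72) where
  "A \<otimes>\<^sub>K B = Matrix.mat (dim_row A * dim_row B) (dim_col A * dim_col B)
     (\<lambda>(i, j). A $$ (i div dim_row B, j div dim_col B) * B $$ (i mod dim_row B, j mod dim_col B))"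

text \<open>Column stacking: entry \<open>(a, b)\<close> is at position \<open>b * dim_row A + a\<close>.\<close>

definition vec_stack :: "real mat \<Rightarrow> real Matrix.vec" where
  "vec_stack A = Matrix.vec (dim_row A * dim_col A)
     (\<lambda>l. A $$ (l mod dim_row A, l div dim_row A))"

text \<open>Only meaningful where the respective equation has a unique solution, e.g. for stable \<open>A\<close>.\<close>

definition lyap_Y :: "real mat \<Rightarrow> real mat \<Rightarrow> real mat" where
  "lyap_Y A Z = (THE Y. Y \<in> carrier_mat (dim_row A) (dim_row A) \<and> A * Y + Y * A\<^sup>T = - Z)"

definition lyap_W :: "real mat \<Rightarrow> real mat" where
  "lyap_W A =
     (THE W. W \<in> carrier_mat (dim_row A) (dim_row A) \<and> A\<^sup>T * W + W * A = - 1\<^sub>m (dim_row A))"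

definition damping :: "nat \<Rightarrow> real mat \<Rightarrow> ('k::finite \<Rightarrow> real mat) \<Rightarrow> real ^ 'k \<Rightarrow> real mat" where
  "damping n Dint D \<nu> = Dint + mat_sum n n (\<lambda>i. \<nu> $ i \<cdot>\<^sub>m (D i * (D i)\<^sup>T))"

definition system_mat :: "nat \<Rightarrow> real mat \<Rightarrow> real mat \<Rightarrow> real mat \<Rightarrow> real mat" where
  "system_mat n \<Omega> \<Phi> D\<nu> = four_block_mat (0\<^sub>m n n) \<Omega> (- \<Omega>) (- (\<Phi>\<^sup>T * D\<nu> * \<Phi>))"

definition U_mat :: "nat \<Rightarrow> real mat \<Rightarrow> real mat \<Rightarrow> real mat" where
  "U_mat n \<Phi> D\<^sub>i = 0\<^sub>m n (dim_col D\<^sub>i) @\<^sub>r (\<Phi>\<^sup>T * D\<^sub>i)"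

definition G_mat :: "nat \<Rightarrow> nat \<Rightarrow> real mat" where
  "G_mat n s = four_block_mat
     (1\<^sub>m s @\<^sub>r 0\<^sub>m (n - s) s) (0\<^sub>m n s)
     (0\<^sub>m n s)                (1\<^sub>m s @\<^sub>r 0\<^sub>m (n - s) s)"

definition Z_mat :: "nat \<Rightarrow> nat \<Rightarrow> real mat" where
  "Z_mat n s = (1 / (2 * real s)) \<cdot>\<^sub>m (G_mat n s * (G_mat n s)\<^sup>T)"

definition P_mat :: "nat \<Rightarrow> real mat \<Rightarrow> real mat" where
  "P_mat n A = 1\<^sub>m (2 * n) \<otimes>\<^sub>K A + A \<otimes>\<^sub>K 1\<^sub>m (2 * n)"

definition U_map :: "('k::finite \<Rightarrow> real mat) \<Rightarrow> real mat \<Rightarrow> real mat \<Rightarrow> real ^ 'k" where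
  "U_map U Y W = (\<chi> i. trace (W\<^sup>T * (U i * (U i)\<^sup>T * Y + Y * (U i * (U i)\<^sup>T))))"

text \<open>
  \<open>idx\<close> numbers the parameters by \<open>0, 1, ..., CARD('k) - 1\<close>: the row belonging to
  the parameter \<open>i\<close> has number \<open>idx i\<close>.
\<close>

definition M_mat :: "nat \<Rightarrow> ('k::finite \<Rightarrow> nat) \<Rightarrow> ('k \<Rightarrow> real mat) \<Rightarrow> real mat \<Rightarrow> real mat" where
  "M_mat n idx U Y = mat\<^sub>r CARD('k) (4 * n\<^sup>2)
     (\<lambda>a. let i = inv_into UNIV idx a in vec_stack (U i * (U i)\<^sup>T * Y + Y * (U i * (U i)\<^sup>T)))"

definition N_mat :: "nat \<Rightarrow> ('k::finite \<Rightarrow> nat) \<Rightarrow> ('k \<Rightarrow> real mat) \<Rightarrow> real mat \<Rightarrow> real mat" where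
  "N_mat n idx U W = mat\<^sub>r CARD('k) (4 * n\<^sup>2)
     (\<lambda>a. let i = inv_into UNIV idx a in vec_stack (W * (U i * (U i)\<^sup>T) + U i * (U i)\<^sup>T * W))"

definition to_square :: "('k::finite \<Rightarrow> nat) \<Rightarrow> real mat \<Rightarrow> real ^ 'k ^ 'k" where
  "to_square idx B = (\<chi> i j. B $$ (idx i, idx j))"

text \<open>
  \<open>H\<close> is the Hessian of \<open>f\<close> at \<open>x\<close>: \<open>f\<close> has a gradient near \<open>x\<close>, and the
  (Frechet) derivative of the gradient at \<open>x\<close> is given by the matrix \<open>H\<close>.
\<close>

definition has_hessian :: "(real ^ 'k \<Rightarrow> real) \<Rightarrow> real ^ 'k ^ 'k \<Rightarrow> real ^ 'k \<Rightarrow> bool" where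
  "has_hessian f H x \<longleftrightarrow>
     (\<exists>g. (\<forall>\<^sub>F y in nhds x. GDERIV f y :> g y) \<and> (g has_derivative (\<lambda>h. H *v h)) (at x))"

end

theory Submission
  imports Defs "Jordan_Normal_Form.Schur_Decomposition"
begin

text \<open>
  Vectorised, both Lyapunov equations have the matrix \<open>P(\<nu>) = I \<otimes> A(\<nu>) + A(\<nu>) \<otimes> I\<close> or its
  transpose, and \<open>P\<close> is affine in \<open>\<nu>\<close> with symmetric slopes \<open>-Q\<^sub>i\<close>, where
  \<open>Q\<^sub>i = I \<otimes> U\<^sub>iU\<^sub>i\<^sup>T + U\<^sub>iU\<^sub>i\<^sup>T \<otimes> I\<close>. With \<open>P y = z\<close>, \<open>P\<^sup>T w = -e\<close> and \<open>f = e \<bullet> y\<close> the resolvent identity gives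
  the exact formula \<open>f(\<nu> + h) - f(\<nu>) = -\<Sum>\<^sub>j h\<^sub>j w(\<nu>) \<bullet> Q\<^sub>j y(\<nu> + h)\<close>, so that continuity of \<open>y\<close> already
  yields the gradient \<open>-w \<bullet> Q\<^sub>j y\<close>; the same argument for \<open>w \<bullet> Q\<^sub>i y\<close> yields the Hessian.
  Only invertibility of \<open>P(\<nu>)\<close>, an open condition, is needed. It follows from stability: if
  \<open>AX + XA\<^sup>T = 0\<close> with \<open>X \<noteq> 0\<close> and \<open>A\<^sup>TR = RB\<close> with \<open>B\<close> upper triangular, the first nonzero column of
  \<open>XR\<close> is an eigenvector of \<open>A\<close> whose eigenvalue is minus a diagonal entry of \<open>B\<close>, which is itself an
  eigenvalue of \<open>A\<close>.
\<close>

no_notation vec_index (infixl "$" 100)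
no_notation inner (infix "\<bullet>" 70)
notation vec_index (infixl "$v" 100)

section \<open>Vectorisation and Kronecker sums\<close>

lemma mod_less_of_less_mult: "l < m * n \<Longrightarrow> l mod m < (m::nat)"
  by (cases "m = 0") auto

lemma add_mult_less: "j < n \<Longrightarrow> i < m \<Longrightarrow> i + m * j < m * (n::nat)"
proof -
  assume "j < n" "i < m"
  then have "i + m * j < m * Suc j" by simp
  also have "\<dots> \<le> m * n" using \<open>j < n\<close> by (intro mult_le_mono2) simp
  finally show ?thesis .
qed

text \<open>The map \<open>l\<close> to \<open>(l div m, l mod m)\<close> is a bijection onto
  column-row pairs; this turns sums over positions of a stacked matrix into double sums over its
  entries.\<close>

lemma sum_mod_div:
  fixes g :: "nat \<Rightarrow> nat \<Rightarrow> 'a::comm_monoid_add"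
  shows "(\<Sum>l<m * n. g (l mod m) (l div m)) = (\<Sum>j<n. \<Sum>i<m. g i j)"
proof -
  have "(\<Sum>l<m * n. g (l mod m) (l div m)) = (\<Sum>(j, i)\<in>{..<n} \<times> {..<m}. g i j)"
    by (rule sum.reindex_bij_witness[where i = "\<lambda>(j, i). j * m + i" and j = "\<lambda>l. (l div m, l mod m)"])
      (auto simp: less_mult_imp_div_less add.commute mult.commute[of _ m] mod_less_of_less_mult add_mult_less)
  then show ?thesis
    by (simp add: sum.cartesian_product)
qed

section \<open>Column stacking and the Frobenius inner product\<close>

lemma dim_vec_stack[simp]: "dim_vec (vec_stack X) = dim_row X * dim_col X"
  by (simp add: vec_stack_def)

lemma vec_stack_carrier: "X \<in> carrier_mat m n \<Longrightarrow> vec_stack X \<in> carrier_vec (m * n)"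
  by (simp add: vec_stack_def)

lemma vec_stack_index:
  "X \<in> carrier_mat m n \<Longrightarrow> l < m * n \<Longrightarrow> vec_stack X $v l = X $$ (l mod m, l div m)"
  by (auto simp: vec_stack_def)

lemma vec_stack_inj:
  assumes X: "X \<in> carrier_mat m n" and Y: "Y \<in> carrier_mat m n" and eq: "vec_stack X = vec_stack Y"
  shows "X = Y"
proof (rule eq_matI)
  fix i j assume "i < dim_row Y" "j < dim_col Y"
  then have ij: "i < m" "j < n" using Y by auto
  then have l: "j * m + i < m * n" using add_mult_less[of j n i m] by (simp add: ac_simps)
  have "vec_stack X $v (j * m + i) = vec_stack Y $v (j * m + i)" by (simp add: eq)
  then show "X $$ (i, j) = Y $$ (i, j)"
    using ij by (simp add: vec_stack_index[OF X l] vec_stack_index[OF Y l])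
qed (use X Y in auto)

lemma vec_stack_surj:
  assumes v: "v \<in> carrier_vec (m * n)"
  obtains X where "X \<in> carrier_mat m n" "vec_stack X = v"
proof
  let ?X = "Matrix.mat m n (\<lambda>(i, j). v $v (j * m + i))"
  show "?X \<in> carrier_mat m n" by simp
  show "vec_stack ?X = v"
  proof (rule eq_vecI)
    fix l assume "l < dim_vec v"
    then have l: "l < m * n" using v by simp
    then have "0 < m" by (cases m) auto
    with l show "vec_stack ?X $v l = v $v l"
      by (subst vec_stack_index[of _ m n]) (auto simp: less_mult_imp_div_less mult.commute)
  qed (use v in auto)
qed

lemma vec_stack_uminus: "vec_stack (- X) = - vec_stack X"
proof (rule eq_vecI)
  fix l assume "l < dim_vec (- vec_stack X)"
  then have l: "l < dim_row X * dim_col X" by simp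
  then have "0 < dim_row X" by (cases "dim_row X") auto
  with l show "vec_stack (- X) $v l = (- vec_stack X) $v l"
    by (auto simp: vec_stack_def less_mult_imp_div_less mult.commute)
qed simp

text \<open>Column stacking is an isometry for the Frobenius inner product. It converts the traces
  in the function and in its gradient into scalar products.\<close>

lemma scalar_prod_vec_stack:
  assumes X: "X \<in> carrier_mat m n" and Y: "Y \<in> carrier_mat m n"
  shows "vec_stack X \<bullet> vec_stack Y = trace (X\<^sup>T * Y)"
proof -
  have "vec_stack X \<bullet> vec_stack Y
      = (\<Sum>l<m * n. X $$ (l mod m, l div m) * Y $$ (l mod m, l div m))"
    using X Y by (auto simp: scalar_prod_def vec_stack_index atLeast0LessThan intro!: sum.cong)
  also have "\<dots> = (\<Sum>j<n. \<Sum>i<m. X $$ (i, j) * Y $$ (i, j))"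
    by (rule sum_mod_div)
  also have "\<dots> = trace (X\<^sup>T * Y)"
    using X Y by (auto simp: trace_def scalar_prod_def atLeast0LessThan intro!: sum.cong)
  finally show ?thesis .
qed

text \<open>The construction behind \<open>P_mat\<close> for an arbitrary size: it is applied to the
  system matrix, to its transpose and to the products \<open>U i * (U i)\<^sup>T\<close>.\<close>

definition kronecker_sum :: "nat \<Rightarrow> real mat \<Rightarrow> real mat" where
  "kronecker_sum N A = 1\<^sub>m N \<otimes>\<^sub>K A + A \<otimes>\<^sub>K 1\<^sub>m N"

lemma kronecker_sum_carrier:
  "X \<in> carrier_mat N N \<Longrightarrow> kronecker_sum N X \<in> carrier_mat (N * N) (N * N)"
  by (auto simp: kronecker_sum_def kronecker_def)

text \<open>Each identity factor is a Kronecker delta, on \<open>div\<close> (the column of the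
  stacked matrix) in one summand and on \<open>mod\<close> (its row) in the other.\<close>

lemma kronecker_sum_index:
  assumes X: "X \<in> carrier_mat N N" and "l < N * N" "k < N * N"
  shows "kronecker_sum N X $$ (l, k) =
    (if l div N = k div N then X $$ (l mod N, k mod N) else 0) +
    (if l mod N = k mod N then X $$ (l div N, k div N) else 0)"
proof -
  have "0 < N" using assms by (cases N) auto
  then show ?thesis
    using assms by (auto simp: kronecker_sum_def kronecker_def less_mult_imp_div_less)
qed

lemma transpose_kronecker_sum:
  assumes X: "X \<in> carrier_mat N N"
  shows "(kronecker_sum N X)\<^sup>T = kronecker_sum N X\<^sup>T"
proof (rule eq_matI)
  have X': "X\<^sup>T \<in> carrier_mat N N" using X by simp
  show "dim_row (kronecker_sum N X)\<^sup>T = dim_row (kronecker_sum N X\<^sup>T)" "dim_col (kronecker_sum N X)\<^sup>T = dim_col (kronecker_sum N X\<^sup>T)"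
    using kronecker_sum_carrier[OF X] kronecker_sum_carrier[OF X'] by auto
  fix l k assume "l < dim_row (kronecker_sum N X\<^sup>T)" "k < dim_col (kronecker_sum N X\<^sup>T)"
  then have lk: "l < N * N" "k < N * N" using kronecker_sum_carrier[OF X'] by auto
  then have "0 < N" by (cases N) auto
  with lk show "(kronecker_sum N X)\<^sup>T $$ (l, k) = kronecker_sum N X\<^sup>T $$ (l, k)"
    using X kronecker_sum_carrier[OF X]
    by (auto simp: kronecker_sum_index[OF X] kronecker_sum_index[OF X'] less_mult_imp_div_less)
qed

text \<open>The factor with the identity on the left acts on columns and gives \<open>A * X\<close>;
  the one with the identity on the right acts on rows and gives the product with the transpose.
  Entrywise, each delta collapses one of two nested sums.\<close>

lemma kronecker_sum_mult_vec_stack: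
  assumes A: "A \<in> carrier_mat N N" and X: "X \<in> carrier_mat N N"
  shows "kronecker_sum N A *\<^sub>v vec_stack X = vec_stack (A * X + X * A\<^sup>T)"
proof (rule eq_vecI)
  have R: "A * X + X * A\<^sup>T \<in> carrier_mat N N" using A X by simp
  show "dim_vec (kronecker_sum N A *\<^sub>v vec_stack X) = dim_vec (vec_stack (A * X + X * A\<^sup>T))"
    using kronecker_sum_carrier[OF A] carrier_matD[OF R] by (simp del: index_add_mat index_mult_mat)
  fix l assume "l < dim_vec (vec_stack (A * X + X * A\<^sup>T))"
  then have l: "l < N * N" unfolding dim_vec_stack carrier_matD[OF R] .
  then have "0 < N" by (cases N) auto
  define a b where "a = l mod N" and "b = l div N"
  have ab: "a < N" "b < N" using l \<open>0 < N\<close> by (auto simp: a_def b_def less_mult_imp_div_less)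
  have "(kronecker_sum N A *\<^sub>v vec_stack X) $v l
      = (\<Sum>k<N * N. ((if b = k div N then A $$ (a, k mod N) else 0)
          + (if a = k mod N then A $$ (b, k div N) else 0)) * X $$ (k mod N, k div N))"
    using kronecker_sum_carrier[OF A] X l
    by (auto simp: scalar_prod_def vec_stack_index[OF X] kronecker_sum_index[OF A] a_def b_def
        atLeast0LessThan intro!: sum.cong)
  also have "\<dots> = (\<Sum>j<N. \<Sum>i<N. ((if b = j then A $$ (a, i) else 0)
          + (if a = i then A $$ (b, j) else 0)) * X $$ (i, j))"
    by (rule sum_mod_div)
  also have "\<dots> = (\<Sum>j<N. \<Sum>i<N. (if b = j then A $$ (a, i) * X $$ (i, j) else 0))
      + (\<Sum>j<N. \<Sum>i<N. (if a = i then A $$ (b, j) * X $$ (i, j) else 0))"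
    unfolding sum.distrib[symmetric] by (intro sum.cong) (auto simp: algebra_simps)
  also have "(\<Sum>j<N. \<Sum>i<N. (if b = j then A $$ (a, i) * X $$ (i, j) else 0))
      = (\<Sum>i<N. A $$ (a, i) * X $$ (i, b))"
    by (subst sum.swap) (use ab in simp)
  also have "(\<Sum>j<N. \<Sum>i<N. (if a = i then A $$ (b, j) * X $$ (i, j) else 0))
      = (\<Sum>j<N. X $$ (a, j) * A $$ (b, j))"
    using ab by (simp add: mult.commute)
  also have "(\<Sum>i<N. A $$ (a, i) * X $$ (i, b)) + (\<Sum>j<N. X $$ (a, j) * A $$ (b, j))
      = (A * X + X * A\<^sup>T) $$ (a, b)"
    using A X ab by (auto simp: scalar_prod_def atLeast0LessThan)
  also have "\<dots> = vec_stack (A * X + X * A\<^sup>T) $v l"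
    using l by (simp add: vec_stack_index[OF R] a_def b_def)
  finally show "(kronecker_sum N A *\<^sub>v vec_stack X) $v l = vec_stack (A * X + X * A\<^sup>T) $v l" .
qed

section \<open>Invertibility from stability\<close>

lemma complex_lyapunov_injective:
  fixes A X :: "complex mat"
  assumes A: "A \<in> carrier_mat m m" and X: "X \<in> carrier_mat m m"
    and ev: "\<And>z. eigenvalue A z \<Longrightarrow> Re z < 0"
    and eq: "A * X + X * A\<^sup>T = 0\<^sub>m m m"
  shows "X = 0\<^sub>m m m"
proof (rule ccontr)
  assume nz: "X \<noteq> 0\<^sub>m m m"
  have At: "A\<^sup>T \<in> carrier_mat m m" using A by simp
  \<comment> \<open>Over the complex numbers the characteristic polynomial splits, as the Schur
    decomposition requires.\<close>
  obtain es where "char_poly A\<^sup>T = (\<Prod>a\<leftarrow>es. [:- a, 1:])"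
    using char_poly_factorized[OF At] by blast
  from schur_decomposition_exists[OF At this] obtain B P Q
    where B: "B \<in> carrier_mat m m" "upper_triangular B" and wit: "similar_mat_wit A\<^sup>T B P Q"
    unfolding similar_mat_def by blast
  note w = similar_mat_witD2[OF At wit]
  have P: "P \<in> carrier_mat m m" and Q: "Q \<in> carrier_mat m m" using w by auto
  \<comment> \<open>The similarity is multiplied by \<open>P\<close> from the right, where
    \<open>Q * P\<close> is the identity. This \<open>P\<close> is the matrix R of the
    overview.\<close>
  have "A\<^sup>T * P = P * B * (Q * P)"
    using w P Q B by (simp add: assoc_mult_mat[of _ m m _ m _ m])
  then have AP: "A\<^sup>T * P = P * B" using w P B by simp
  define V where "V = X * P"
  have V: "V \<in> carrier_mat m m" using X P by (simp add: V_def)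
  have "V \<noteq> 0\<^sub>m m m"
  proof
    assume "V = 0\<^sub>m m m"
    then have "X * (P * Q) = 0\<^sub>m m m"
      using X P Q by (simp add: V_def assoc_mult_mat[of _ m m _ m _ m, symmetric])
    with w X nz show False by simp
  qed
  then have "\<exists>j. j < m \<and> (\<exists>a<m. V $$ (a, j) \<noteq> 0)" using V by (auto intro!: eq_matI)
  \<comment> \<open>The least index of a nonzero column, so that all columns to its left
    vanish.\<close>
  then obtain j where j: "j < m" "\<exists>a<m. V $$ (a, j) \<noteq> 0"
    and min: "\<And>i. i < j \<Longrightarrow> \<not> (i < m \<and> (\<exists>a<m. V $$ (a, i) \<noteq> 0))"
    using exists_least_iff[of "\<lambda>j. j < m \<and> (\<exists>a<m. V $$ (a, j) \<noteq> 0)"] by blast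
  have "(A * X + X * A\<^sup>T) * P = A * V + V * B"
    using A At X P B AP unfolding V_def
    by (simp add: add_mult_distrib_mat[of _ m m _ _ m] assoc_mult_mat[of _ m m _ m _ m])
  then have AV: "A * V + V * B = 0\<^sub>m m m" using eq P by simp
  \<comment> \<open>Only the diagonal term survives: the terms with \<open>i < j\<close> vanish by
    minimality of \<open>j\<close>, those with \<open>j < i\<close> because \<open>B\<close> is
    upper triangular.\<close>
  have VB: "(V * B) $$ (a, j) = V $$ (a, j) * B $$ (j, j)" if "a < m" for a
  proof -
    have "(V * B) $$ (a, j) = (\<Sum>i<m. V $$ (a, i) * B $$ (i, j))"
      using V B j that by (simp add: scalar_prod_def atLeast0LessThan)
    also have "\<dots> = (\<Sum>i<m. if i = j then V $$ (a, j) * B $$ (j, j) else 0)"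
    proof (rule sum.cong)
      fix i assume "i \<in> {..<m}"
      moreover have "V $$ (a, i) = 0" if "i < j" using min[OF that] \<open>a < m\<close> j that by auto
      moreover have "B $$ (i, j) = 0" if "j < i" "i < m"
        using B that by (auto simp: upper_triangular_def)
      ultimately show "V $$ (a, i) * B $$ (i, j) = (if i = j then V $$ (a, j) * B $$ (j, j) else 0)"
        by (cases i j rule: linorder_cases) auto
    qed simp
    finally show ?thesis using j by simp
  qed
  \<comment> \<open>This is column \<open>j\<close> of the equation
    \<open>A * V + V * B = 0\<close>.\<close>
  have "A *\<^sub>v col V j = (- B $$ (j, j)) \<cdot>\<^sub>v col V j"
  proof (rule eq_vecI)
    fix a assume "a < dim_vec ((- B $$ (j, j)) \<cdot>\<^sub>v col V j)"
    then have a: "a < m" using V by simp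
    have "(A * V + V * B) $$ (a, j) = 0" using AV a j by simp
    then have "(A * V) $$ (a, j) + V $$ (a, j) * B $$ (j, j) = 0"
      using V B A a j VB[OF a] by simp
    moreover have "(A * V) $$ (a, j) = (A *\<^sub>v col V j) $v a" using A V a j by simp
    ultimately show "(A *\<^sub>v col V j) $v a = ((- B $$ (j, j)) \<cdot>\<^sub>v col V j) $v a"
      using V a j by (simp add: add_eq_0_iff2 mult.commute)
  qed (use A V in auto)
  moreover have "col V j \<noteq> 0\<^sub>v m"
  proof
    assume "col V j = 0\<^sub>v m"
    then have "V $$ (a, j) = 0" if "a < m" for a
      using V j that by (metis carrier_matD index_col index_zero_vec(1))
    with j show False by auto
  qed
  ultimately have "eigenvalue A (- B $$ (j, j))"
    unfolding eigenvalue_def eigenvector_def using A V j by (auto intro!: exI[of _ "col V j"])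
  then have "Re (- B $$ (j, j)) < 0" by (rule ev)
  \<comment> \<open>\<open>A\<close>, its transpose and \<open>B\<close> share their characteristic
    polynomial, whose roots are the diagonal entries of \<open>B\<close>. Hence a number and its
    negative would both have negative real part.\<close>
  moreover have "eigenvalue A (B $$ (j, j))"
  proof -
    have "similar_mat A\<^sup>T B" using wit by (auto simp: similar_mat_def)
    then have "char_poly A = char_poly B"
      using char_poly_similar char_poly_transpose_mat[OF A] by metis
    also have "\<dots> = (\<Prod>a\<leftarrow>diag_mat B. [:- a, 1:])" by (rule char_poly_upper_triangular[OF B])
    finally have "poly (char_poly A) (B $$ (j, j)) = (\<Prod>a\<leftarrow>diag_mat B. B $$ (j, j) - a)"
      by (simp add: poly_prod_list o_def)
    also have "\<dots> = 0" using B j by (auto simp: prod_list_zero_iff diag_mat_def)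
    finally show ?thesis by (simp add: eigenvalue_root_char_poly[OF A])
  qed
  then have "Re (B $$ (j, j)) < 0" by (rule ev)
  ultimately show False by simp
qed

text \<open>Stability speaks of complex eigenvalues, so the real equation is embedded into the
  complex matrices and the vanishing of the entries is pulled back.\<close>

lemma stable_lyapunov_injective:
  assumes A: "A \<in> carrier_mat m m" and X: "X \<in> carrier_mat m m" and st: "stable A"
    and eq: "A * X + X * A\<^sup>T = 0\<^sub>m m m"
  shows "X = 0\<^sub>m m m"
proof -
  let ?c = "map_mat complex_of_real"
  have cA: "?c A \<in> carrier_mat m m" and cX: "?c X \<in> carrier_mat m m" using A X by simp_all
  have "?c A * ?c X + ?c X * (?c A)\<^sup>T = ?c (A * X + X * A\<^sup>T)"
    using A X by (auto intro!: eq_matI simp: scalar_prod_def)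
  also have "\<dots> = 0\<^sub>m m m" unfolding eq by auto
  finally have ceq: "?c A * ?c X + ?c X * (?c A)\<^sup>T = 0\<^sub>m m m" .
  have cst: "Re z < 0" if "eigenvalue (?c A) z" for z
    using st that unfolding stable_def by blast
  have "?c X = 0\<^sub>m m m"
    by (rule complex_lyapunov_injective[OF cA cX cst ceq])
  then have "?c X $$ (i, j) = 0" if "i < m" "j < m" for i j using that by simp
  then have "X $$ (i, j) = 0" if "i < m" "j < m" for i j using that X by simp
  then show ?thesis using X by (auto intro!: eq_matI)
qed

text \<open>A kernel vector of the Kronecker sum, unstacked, would be a nonzero solution of the
  homogeneous Lyapunov equation.\<close>

lemma stable_det_kronecker_sum:
  assumes A: "A \<in> carrier_mat N N" and st: "stable A"
  shows "det (kronecker_sum N A) \<noteq> 0"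
proof
  assume "det (kronecker_sum N A) = 0"
  then obtain v where v: "v \<in> carrier_vec (N * N)" "v \<noteq> 0\<^sub>v (N * N)"
      "kronecker_sum N A *\<^sub>v v = 0\<^sub>v (N * N)"
    using det_0_iff_vec_prod_zero[OF kronecker_sum_carrier[OF A]] by blast
  obtain X where X: "X \<in> carrier_mat N N" "vec_stack X = v" using vec_stack_surj[OF v(1)] .
  have zero: "vec_stack (0\<^sub>m N N) = 0\<^sub>v (N * N)"
    by (intro eq_vecI) (auto simp: vec_stack_def less_mult_imp_div_less mod_less_of_less_mult)
  have "vec_stack (A * X + X * A\<^sup>T) = vec_stack (0\<^sub>m N N)"
    using kronecker_sum_mult_vec_stack[OF A X(1)] X(2) v(3) zero by simp
  then have "A * X + X * A\<^sup>T = 0\<^sub>m N N"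
    using A X by (intro vec_stack_inj[of _ N N]) auto
  then have "X = 0\<^sub>m N N" by (rule stable_lyapunov_injective[OF A X(1) st])
  with X(2) v(2) zero show False by simp
qed

section \<open>Derivatives of solutions of affine linear systems\<close>

lemma minv_inverse:
  assumes A: "A \<in> carrier_mat n n" and d: "det A \<noteq> 0"
  shows "minv A \<in> carrier_mat n n" "A * minv A = 1\<^sub>m n" "minv A * A = 1\<^sub>m n"
proof -
  have "A \<in> Units (ring_mat TYPE(real) n ())" by (rule det_non_zero_imp_unit[OF A d])
  then obtain B where "mat_inverse A = Some B"
    using mat_inverse(1)[OF A, of "()"] by (cases "mat_inverse A") auto
  then show "minv A \<in> carrier_mat n n" "A * minv A = 1\<^sub>m n" "minv A * A = 1\<^sub>m n"
    using mat_inverse(2)[OF A] by (auto simp: minv_def)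
qed

lemma minv_unique:
  assumes A: "A \<in> carrier_mat n n" and d: "det A \<noteq> 0"
    and B: "B \<in> carrier_mat n n" and AB: "A * B = 1\<^sub>m n"
  shows "minv A = B"
proof -
  have "minv A = minv A * (A * B)" using minv_inverse[OF A d] AB by simp
  also have "\<dots> = (minv A * A) * B"
    using A B minv_inverse(1)[OF A d] by (simp add: assoc_mult_mat[of _ n n _ n _ n])
  also have "\<dots> = B" using B minv_inverse[OF A d] by simp
  finally show ?thesis .
qed

lemma minv_transpose:
  assumes A: "A \<in> carrier_mat n n" and d: "det A \<noteq> 0"
  shows "minv A\<^sup>T = (minv A)\<^sup>T"
proof (rule minv_unique)
  show "det A\<^sup>T \<noteq> 0" using d by (simp add: det_transpose[OF A])
  have "A\<^sup>T * (minv A)\<^sup>T = (minv A * A)\<^sup>T"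
    using A minv_inverse(1)[OF A d] by (simp add: transpose_mult)
  then show "A\<^sup>T * (minv A)\<^sup>T = 1\<^sub>m n" using minv_inverse[OF A d] by simp
qed (use A minv_inverse(1)[OF A d] in auto)

text \<open>
  Unlike \<open>minv\<close>, this has the dimensions of \<open>A\<close> also for singular \<open>A\<close>, and its entries are visibly
  continuous where \<open>det A \<noteq> 0\<close>.
\<close>

definition adj_inverse :: "real mat \<Rightarrow> real mat" where
  "adj_inverse A = (1 / det A) \<cdot>\<^sub>m adj_mat A"

lemma adj_inverse_carrier: "A \<in> carrier_mat n n \<Longrightarrow> adj_inverse A \<in> carrier_mat n n"
  using adj_mat(1)[of A n] by (simp add: adj_inverse_def)

text \<open>By the adjugate identity, \<open>A * adj_mat A\<close> is \<open>det A\<close> times the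
  identity. This links \<open>minv\<close> to a formula that can be checked for continuity.\<close>

lemma minv_eq_adj_inverse:
  assumes A: "A \<in> carrier_mat n n" and d: "det A \<noteq> 0"
  shows "minv A = adj_inverse A"
proof (rule minv_unique[OF A d adj_inverse_carrier[OF A]])
  have "A * adj_inverse A = (1 / det A) \<cdot>\<^sub>m (det A \<cdot>\<^sub>m 1\<^sub>m n)"
    using A adj_mat[OF A] by (simp add: adj_inverse_def mult_smult_distrib)
  also have "\<dots> = 1\<^sub>m n" using d by (intro eq_matI) auto
  finally show "A * adj_inverse A = 1\<^sub>m n" .
qed

lemma minv_mult_vec_unique:
  assumes A: "A \<in> carrier_mat n n" and d: "det A \<noteq> 0"
    and v: "v \<in> carrier_vec n" and eq: "A *\<^sub>v v = u"
  shows "v = minv A *\<^sub>v u"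
proof -
  have "minv A *\<^sub>v u = (minv A * A) *\<^sub>v v"
    using A v eq minv_inverse(1)[OF A d] by (simp add: assoc_mult_mat_vec[of _ n n _ n])
  then show ?thesis using v minv_inverse[OF A d] by simp
qed

lemma mult_minv_vec:
  assumes A: "A \<in> carrier_mat n n" and d: "det A \<noteq> 0" and v: "v \<in> carrier_vec n"
  shows "A *\<^sub>v (minv A *\<^sub>v v) = v"
  unfolding assoc_mult_mat_vec[OF A minv_inverse(1)[OF A d] v, symmetric] minv_inverse(2)[OF A d]
  using v by simp

lemma scalar_prod_transpose_mult:
  assumes "A \<in> carrier_mat n m" "u \<in> carrier_vec n" "v \<in> carrier_vec m"
  shows "(A\<^sup>T *\<^sub>v u) \<bullet> v = u \<bullet> (A *\<^sub>v (v::real Matrix.vec))"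
  using transpose_vec_mult_scalar[OF assms(1) assms(3) assms(2)] by simp

lemma mult_mat_vec_uminus:
  assumes "B \<in> carrier_mat k m" and "(v::real Matrix.vec) \<in> carrier_vec m"
  shows "B *\<^sub>v (- v) = - (B *\<^sub>v v)"
  using assms by (intro eq_vecI) (simp_all add: scalar_prod_uminus_right)

section \<open>Continuity of determinants, inverses and products\<close>

lemma isCont_det:
  fixes F :: "'a::t2_space \<Rightarrow> real mat"
  assumes F: "\<And>x. F x \<in> carrier_mat m m"
    and c: "\<And>i j. i < m \<Longrightarrow> j < m \<Longrightarrow> isCont (\<lambda>x. F x $$ (i, j)) x0"
  shows "isCont (\<lambda>x. det (F x)) x0"
proof -
  \<comment> \<open>By the Leibniz formula the determinant is a polynomial in the entries.\<close>
  have "isCont (\<lambda>x. \<Sum>p\<in>{p. p permutes {0..<m}}. signof p * (\<Prod>i = 0..<m. F x $$ (i, p i))) x0"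
    by (intro continuous_intros c) (auto simp: permutes_in_image)
  then show ?thesis by (simp add: det_def'[OF F])
qed

text \<open>A cofactor is a signed minor, and the entries of the minor are entries of the matrix
  with indices shifted past the deleted row and column.\<close>

lemma isCont_cofactor:
  fixes F :: "'a::t2_space \<Rightarrow> real mat"
  assumes F: "\<And>x. F x \<in> carrier_mat m m"
    and c: "\<And>i j. i < m \<Longrightarrow> j < m \<Longrightarrow> isCont (\<lambda>x. F x $$ (i, j)) x0"
    and ij: "i < m" "j < m"
  shows "isCont (\<lambda>x. cofactor (F x) i j) x0"
proof -
  have "isCont (\<lambda>x. det (mat_delete (F x) i j)) x0"
  proof (rule isCont_det)
    show "mat_delete (F x) i j \<in> carrier_mat (m - 1) (m - 1)" for x
      using F[of x] by (simp add: mat_delete_def)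
    fix a b assume ab: "a < m - 1" "b < m - 1"
    have "isCont (\<lambda>x. F x $$ (if a < i then a else Suc a, if b < j then b else Suc b)) x0"
      by (rule c) (use ab in auto)
    moreover have "mat_delete (F x) i j $$ (a, b)
        = F x $$ (if a < i then a else Suc a, if b < j then b else Suc b)" for x
      using carrier_matD[OF F[of x]] ab by (simp add: mat_delete_def)
    ultimately show "isCont (\<lambda>x. mat_delete (F x) i j $$ (a, b)) x0" by simp
  qed
  then show ?thesis unfolding cofactor_def by (intro continuous_intros)
qed

lemma isCont_adj_inverse:
  fixes F :: "'a::t2_space \<Rightarrow> real mat"
  assumes F: "\<And>x. F x \<in> carrier_mat m m"
    and c: "\<And>i j. i < m \<Longrightarrow> j < m \<Longrightarrow> isCont (\<lambda>x. F x $$ (i, j)) x0"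
    and d: "det (F x0) \<noteq> 0" and ij: "i < m" "j < m"
  shows "isCont (\<lambda>x. adj_inverse (F x) $$ (i, j)) x0"
proof -
  have "isCont (\<lambda>x. det (F x)) x0" by (rule isCont_det[OF F c])
  moreover have "isCont (\<lambda>x. cofactor (F x) j i) x0" by (rule isCont_cofactor[OF F c ij(2,1)])
  ultimately have "isCont (\<lambda>x. 1 / det (F x) * cofactor (F x) j i) x0"
    using d by (intro continuous_intros) auto
  moreover have "adj_inverse (F x) $$ (i, j) = 1 / det (F x) * cofactor (F x) j i" for x
    using carrier_matD[OF F[of x]] ij by (simp add: adj_inverse_def adj_mat_def)
  ultimately show ?thesis by simp
qed

lemma isCont_scalar_prod:
  fixes u v :: "'a::t2_space \<Rightarrow> real Matrix.vec"
  assumes v: "\<And>x. v x \<in> carrier_vec m"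
    and "\<And>l. l < m \<Longrightarrow> isCont (\<lambda>x. u x $v l) x0" "\<And>l. l < m \<Longrightarrow> isCont (\<lambda>x. v x $v l) x0"
  shows "isCont (\<lambda>x. u x \<bullet> v x) x0"
  unfolding scalar_prod_def carrier_vecD[OF v]
  by (intro continuous_sum continuous_mult assms(2,3)) simp_all

lemma isCont_mult_mat_vec:
  fixes F :: "'a::t2_space \<Rightarrow> real mat" and v :: "'a \<Rightarrow> real Matrix.vec"
  assumes F: "\<And>x. F x \<in> carrier_mat k m" and v: "\<And>x. v x \<in> carrier_vec m"
    and cF: "\<And>i j. i < k \<Longrightarrow> j < m \<Longrightarrow> isCont (\<lambda>x. F x $$ (i, j)) x0"
    and cv: "\<And>l. l < m \<Longrightarrow> isCont (\<lambda>x. v x $v l) x0" and l: "l < k"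
  shows "isCont (\<lambda>x. (F x *\<^sub>v v x) $v l) x0"
proof -
  have "isCont (\<lambda>x. row (F x) l \<bullet> v x) x0"
  proof (rule isCont_scalar_prod[OF v _ cv])
    fix j assume j: "j < m"
    have "row (F x) l $v j = F x $$ (l, j)" for x using F[of x] l j by simp
    then show "isCont (\<lambda>x. row (F x) l $v j) x0" using cF[OF l j] by simp
  qed
  moreover have "(F x *\<^sub>v v x) $v l = row (F x) l \<bullet> v x" for x using F[of x] l by simp
  ultimately show ?thesis by simp
qed

text \<open>Caratheodory's form of differentiability in several variables: an exact increment
  formula whose slopes are continuous at the base point. The slopes may be taken at the moving
  point, so no remainder has to be estimated when the lemma is applied.\<close>

lemma has_derivative_from_slopes:
  fixes F :: "real ^ 'k::finite \<Rightarrow> real"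
  assumes eq: "\<forall>\<^sub>F y in nhds x. F y - F x = (\<Sum>j\<in>UNIV. (y $ j - x $ j) * c j y)"
    and c: "\<And>j. isCont (c j) x"
  shows "(F has_derivative (\<lambda>h. \<Sum>j\<in>UNIV. h $ j * c j x)) (at x)"
  unfolding has_derivative_iff_norm
proof
  show "bounded_linear (\<lambda>h. \<Sum>j\<in>UNIV. h $ j * c j x)"
    by (intro bounded_linear_sum bounded_linear_mult_const bounded_linear_vec_nth)
  \<comment> \<open>The total change of the slopes will bound the difference quotient of the
    remainder.\<close>
  have "((\<lambda>y. \<Sum>j\<in>UNIV. \<bar>c j y - c j x\<bar>) \<longlongrightarrow> (\<Sum>j\<in>UNIV. \<bar>c j x - c j x\<bar>)) (at x)"
    by (intro tendsto_intros c[unfolded isCont_def])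
  then have lim: "((\<lambda>y. \<Sum>j\<in>UNIV. \<bar>c j y - c j x\<bar>) \<longlongrightarrow> 0) (at x)" by simp
  show "((\<lambda>y. norm (F y - F x - (\<Sum>j\<in>UNIV. (y - x) $ j * c j x)) / norm (y - x)) \<longlongrightarrow> 0) (at x)"
  proof (rule Lim_null_comparison[OF _ lim])
    have "\<forall>\<^sub>F y in at x. F y - F x = (\<Sum>j\<in>UNIV. (y $ j - x $ j) * c j y)"
      using eq by (simp add: eventually_nhds_conv_at)
    then show "\<forall>\<^sub>F y in at x. norm (norm (F y - F x - (\<Sum>j\<in>UNIV. (y - x) $ j * c j x)) / norm (y - x))
        \<le> (\<Sum>j\<in>UNIV. \<bar>c j y - c j x\<bar>)"
    proof eventually_elim
      case (elim y)
      have "F y - F x - (\<Sum>j\<in>UNIV. (y - x) $ j * c j x) = (\<Sum>j\<in>UNIV. (y - x) $ j * (c j y - c j x))"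
        unfolding elim by (simp add: sum_subtractf[symmetric] algebra_simps)
      also have "\<bar>\<dots>\<bar> \<le> (\<Sum>j\<in>UNIV. norm (y - x) * \<bar>c j y - c j x\<bar>)"
        by (intro order_trans[OF sum_abs] sum_mono)
          (auto simp: abs_mult simp del: vector_minus_component intro!: mult_right_mono component_le_norm_cart)
      finally have "norm (F y - F x - (\<Sum>j\<in>UNIV. (y - x) $ j * c j x))
          \<le> norm (y - x) * (\<Sum>j\<in>UNIV. \<bar>c j y - c j x\<bar>)"
        by (simp add: sum_distrib_left)
      \<comment> \<open>At \<open>y = x\<close> the quotient is a division by zero, which has the
        value 0.\<close>
      then show ?case
        by (cases "y = x") (auto simp: divide_le_eq mult.commute sum_nonneg)
    qed
  qed
qed

text \<open>Affine dependence is stated as a comparison of two arbitrary points, which avoids a base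
  point. The minus sign follows the way the damping enters the system matrix.\<close>

locale affine_pencil =
  fixes m :: nat and P :: "real ^ 'k::finite \<Rightarrow> real mat" and Q :: "'k \<Rightarrow> real mat"
  assumes P: "\<And>\<mu>. P \<mu> \<in> carrier_mat m m"
    and Q: "\<And>i. Q i \<in> carrier_mat m m"
    and Q_sym: "\<And>i. (Q i)\<^sup>T = Q i"
    and P_diff: "\<And>\<mu> \<mu>' a b. a < m \<Longrightarrow> b < m \<Longrightarrow>
      P \<mu>' $$ (a, b) = P \<mu> $$ (a, b) - (\<Sum>j\<in>UNIV. (\<mu>' $ j - \<mu> $ j) * Q j $$ (a, b))"
begin

text \<open>Symmetric slopes survive transposition, so every result on \<open>P\<close> also serves
  the dual equation with the same \<open>Q\<close>.\<close>

lemma affine_pencil_transpose: "affine_pencil m (\<lambda>\<mu>. (P \<mu>)\<^sup>T) Q"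
proof
  fix \<mu> \<mu>' :: "real ^ 'k" and a b assume ab: "a < m" "b < m"
  have "Q j $$ (b, a) = Q j $$ (a, b)" for j
    using Q_sym[of j] Q[of j] ab by (metis carrier_matD index_transpose_mat(1))
  then show "(P \<mu>')\<^sup>T $$ (a, b) = (P \<mu>)\<^sup>T $$ (a, b) - (\<Sum>j\<in>UNIV. (\<mu>' $ j - \<mu> $ j) * Q j $$ (a, b))"
    using carrier_matD[OF P[of \<mu>]] carrier_matD[OF P[of \<mu>']] ab P_diff[of b a \<mu>' \<mu>] by simp
qed (use P Q Q_sym in auto)

lemma isCont_P: "a < m \<Longrightarrow> b < m \<Longrightarrow> isCont (\<lambda>\<mu>. P \<mu> $$ (a, b)) \<mu>"
  by (subst P_diff[of a b _ \<mu>], assumption, assumption) (intro continuous_intros)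

text \<open>Nonsingularity is an open condition because the determinant is continuous.\<close>

lemma eventually_det_P:
  assumes d: "det (P \<mu>) \<noteq> 0"
  shows "\<forall>\<^sub>F \<mu>' in nhds \<mu>. det (P \<mu>') \<noteq> 0"
  using tendsto_imp_eventually_ne[OF isCont_det[OF P isCont_P, of \<mu>, unfolded isCont_def] d] d
  by (simp add: eventually_nhds_conv_at)

lemma scalar_prod_P_diff:
  assumes u: "u \<in> carrier_vec m" and v: "v \<in> carrier_vec m"
  shows "u \<bullet> (P \<mu>' *\<^sub>v v) = u \<bullet> (P \<mu> *\<^sub>v v) - (\<Sum>j\<in>UNIV. (\<mu>' $ j - \<mu> $ j) * (u \<bullet> (Q j *\<^sub>v v)))"
proof -
  have expand: "u \<bullet> (X *\<^sub>v v) = (\<Sum>a<m. \<Sum>b<m. u $v a * X $$ (a, b) * v $v b)"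
    if "X \<in> carrier_mat m m" for X
    using that u v
    by (auto simp: scalar_prod_def atLeast0LessThan sum_distrib_left mult.assoc intro!: sum.cong)
  have "(\<Sum>j\<in>UNIV. (\<mu>' $ j - \<mu> $ j) * (u \<bullet> (Q j *\<^sub>v v)))
      = (\<Sum>a<m. \<Sum>b<m. \<Sum>j\<in>UNIV. (\<mu>' $ j - \<mu> $ j) * (u $v a * Q j $$ (a, b) * v $v b))"
    unfolding expand[OF Q] sum_distrib_left
    by (subst sum.swap, rule sum.cong[OF refl], rule sum.swap)
  also have "\<dots> = (\<Sum>a<m. \<Sum>b<m. u $v a * (P \<mu> $$ (a, b) - P \<mu>' $$ (a, b)) * v $v b)"
    using P_diff[of _ _ \<mu>' \<mu>]
    by (auto simp: sum_distrib_left sum_distrib_right ac_simps intro!: sum.cong)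
  also have "\<dots> = u \<bullet> (P \<mu> *\<^sub>v v) - u \<bullet> (P \<mu>' *\<^sub>v v)"
    unfolding expand[OF P] sum_subtractf[symmetric] by (simp add: algebra_simps)
  finally show ?thesis by simp
qed

text \<open>The solution of the system with matrix \<open>P \<mu>\<close> and right-hand side
  \<open>z\<close> wherever \<open>P \<mu>\<close> is nonsingular. With \<open>adj_inverse\<close>
  the result has dimension \<open>m\<close> at every \<mu>.\<close>

definition sol :: "real Matrix.vec \<Rightarrow> real ^ 'k \<Rightarrow> real Matrix.vec" where
  "sol z \<mu> = adj_inverse (P \<mu>) *\<^sub>v z"

lemma sol_carrier: "sol z \<mu> \<in> carrier_vec m"
  using carrier_matD(1)[OF adj_inverse_carrier[OF P]] by (intro carrier_vecI) (simp add: sol_def)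

lemma P_sol:
  assumes d: "det (P \<mu>) \<noteq> 0" and z: "z \<in> carrier_vec m"
  shows "P \<mu> *\<^sub>v sol z \<mu> = z"
  unfolding sol_def minv_eq_adj_inverse[OF P d, symmetric] by (rule mult_minv_vec[OF P d z])

lemma isCont_sol:
  assumes d: "det (P \<mu>) \<noteq> 0" and z: "z \<in> carrier_vec m" and l: "l < m"
  shows "isCont (\<lambda>\<mu>. sol z \<mu> $v l) \<mu>"
  unfolding sol_def using z l
  by (intro isCont_mult_mat_vec[of _ m m] adj_inverse_carrier P isCont_adj_inverse[OF P isCont_P d])
    auto

lemma isCont_Q_sol:
  assumes d: "det (P \<mu>) \<noteq> 0" and z: "z \<in> carrier_vec m" and l: "l < m"
  shows "isCont (\<lambda>\<mu>. (Q i *\<^sub>v sol z \<mu>) $v l) \<mu>"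
  by (intro isCont_mult_mat_vec[of _ m m] Q sol_carrier isCont_sol assms) auto

lemma Q_sol_carrier: "Q i *\<^sub>v sol z \<mu> \<in> carrier_vec m"
  using carrier_matD(1)[OF Q[of i]] by (intro carrier_vecI) simp

text \<open>The resolvent identity tested against \<open>b\<close>. Both \<open>P \<mu>\<close> and
  \<open>P \<mu>'\<close> send their own solution to \<open>z\<close>, so with \<open>a\<close>
  solving the transposed system for \<open>b\<close> the difference is \<open>a\<close> paired with
  the change of \<open>P\<close> applied to the new solution.\<close>

lemma scalar_prod_sol_diff:
  assumes d: "det (P \<mu>) \<noteq> 0" and d': "det (P \<mu>') \<noteq> 0"
    and z: "z \<in> carrier_vec m" and b: "b \<in> carrier_vec m"
  shows "b \<bullet> sol z \<mu>' - b \<bullet> sol z \<mu>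
    = (\<Sum>j\<in>UNIV. (\<mu>' $ j - \<mu> $ j) * (((minv (P \<mu>))\<^sup>T *\<^sub>v b) \<bullet> (Q j *\<^sub>v sol z \<mu>')))"
proof -
  define a where "a = (minv (P \<mu>))\<^sup>T *\<^sub>v b"
  note inv = minv_inverse[OF P d]
  have a: "a \<in> carrier_vec m" using inv(1) b by (simp add: a_def)
  have Pt: "(P \<mu>)\<^sup>T \<in> carrier_mat m m" using P[of \<mu>] by simp
  have dt: "det (P \<mu>)\<^sup>T \<noteq> 0" using d by (simp add: det_transpose[OF P])
  have "b = (P \<mu>)\<^sup>T *\<^sub>v a"
    using mult_minv_vec[OF Pt dt b] by (simp add: a_def minv_transpose[OF P d])
  then have b_eq: "b \<bullet> v = a \<bullet> (P \<mu> *\<^sub>v v)" if "v \<in> carrier_vec m" for v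
    using scalar_prod_transpose_mult[OF P a that] by simp
  \<comment> \<open>The second term is \<open>a\<close> paired with \<open>z\<close>, and here
    \<open>z\<close> is written through the solution at \<mu>' instead of the one at \<mu>.\<close>
  have "b \<bullet> sol z \<mu>' - b \<bullet> sol z \<mu> = a \<bullet> (P \<mu> *\<^sub>v sol z \<mu>') - a \<bullet> (P \<mu>' *\<^sub>v sol z \<mu>')"
    by (simp add: b_eq sol_carrier P_sol d d' z)
  also have "\<dots> = (\<Sum>j\<in>UNIV. (\<mu>' $ j - \<mu> $ j) * (a \<bullet> (Q j *\<^sub>v sol z \<mu>')))"
    using scalar_prod_P_diff[OF a sol_carrier, of \<mu>' z \<mu>' \<mu>] by simp
  finally show ?thesis by (simp add: a_def)
qed

lemma has_derivative_scalar_prod_sol: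
  assumes d: "det (P \<mu>) \<noteq> 0" and z: "z \<in> carrier_vec m" and b: "b \<in> carrier_vec m"
  shows "((\<lambda>\<mu>. b \<bullet> sol z \<mu>) has_derivative
    (\<lambda>h. \<Sum>j\<in>UNIV. h $ j * (((minv (P \<mu>))\<^sup>T *\<^sub>v b) \<bullet> (Q j *\<^sub>v sol z \<mu>)))) (at \<mu>)"
proof (rule has_derivative_from_slopes
    [where c = "\<lambda>j \<mu>'. ((minv (P \<mu>))\<^sup>T *\<^sub>v b) \<bullet> (Q j *\<^sub>v sol z \<mu>')"])
  show "\<forall>\<^sub>F \<mu>' in nhds \<mu>. b \<bullet> sol z \<mu>' - b \<bullet> sol z \<mu>
    = (\<Sum>j\<in>UNIV. (\<mu>' $ j - \<mu> $ j) * (((minv (P \<mu>))\<^sup>T *\<^sub>v b) \<bullet> (Q j *\<^sub>v sol z \<mu>')))"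
    using eventually_det_P[OF d] by eventually_elim (rule scalar_prod_sol_diff[OF d _ z b])
  show "isCont (\<lambda>\<mu>'. ((minv (P \<mu>))\<^sup>T *\<^sub>v b) \<bullet> (Q j *\<^sub>v sol z \<mu>')) \<mu>" for j
    by (intro isCont_scalar_prod[OF Q_sol_carrier] isCont_Q_sol d z continuous_intros)
qed

text \<open>The transposed pencil is interpreted only inside a proof, so the statement below refers
  to its solutions through the global constant.\<close>

abbreviation dual_sol :: "real Matrix.vec \<Rightarrow> real ^ 'k \<Rightarrow> real Matrix.vec" where
  "dual_sol \<equiv> affine_pencil.sol (\<lambda>\<mu>. (P \<mu>)\<^sup>T)"

text \<open>A product rule for the two solutions. The functional applied to the primal solution
  moves with the point as well, so the exact increment formulas are combined and continuity is used
  only at the end.\<close>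

lemma has_derivative_dual_sol_Q_sol:
  assumes d: "det (P \<mu>) \<noteq> 0" and z: "z \<in> carrier_vec m" and b: "b \<in> carrier_vec m"
  shows "((\<lambda>\<mu>. dual_sol b \<mu> \<bullet> (Q i *\<^sub>v sol z \<mu>)) has_derivative
    (\<lambda>h. \<Sum>j\<in>UNIV. h $ j *
      (((minv (P \<mu>))\<^sup>T *\<^sub>v (Q i *\<^sub>v dual_sol b \<mu>)) \<bullet> (Q j *\<^sub>v sol z \<mu>)
       + (minv (P \<mu>) *\<^sub>v (Q i *\<^sub>v sol z \<mu>)) \<bullet> (Q j *\<^sub>v dual_sol b \<mu>)))) (at \<mu>)"
proof (rule has_derivative_from_slopes
    [where c = "\<lambda>j \<mu>'. ((minv (P \<mu>))\<^sup>T *\<^sub>v (Q i *\<^sub>v dual_sol b \<mu>')) \<bullet> (Q j *\<^sub>v sol z \<mu>')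
       + (minv (P \<mu>) *\<^sub>v (Q i *\<^sub>v sol z \<mu>)) \<bullet> (Q j *\<^sub>v dual_sol b \<mu>')"])
  interpret T: affine_pencil m "\<lambda>\<mu>. (P \<mu>)\<^sup>T" Q by (rule affine_pencil_transpose)
  have dT: "det (P \<mu>)\<^sup>T \<noteq> 0 \<longleftrightarrow> det (P \<mu>) \<noteq> 0" for \<mu> by (simp add: det_transpose[OF P])
  have Q_swap: "u \<bullet> (Q i *\<^sub>v v) = (Q i *\<^sub>v u) \<bullet> v"
    if "u \<in> carrier_vec m" "v \<in> carrier_vec m" for u v
    using scalar_prod_transpose_mult[OF Q that, of i] by (simp add: Q_sym)
  have inv: "minv (P \<mu>) \<in> carrier_mat m m" by (rule minv_inverse[OF P d])
  show "\<forall>\<^sub>F \<mu>' in nhds \<mu>. T.sol b \<mu>' \<bullet> (Q i *\<^sub>v sol z \<mu>') - T.sol b \<mu> \<bullet> (Q i *\<^sub>v sol z \<mu>)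
    = (\<Sum>j\<in>UNIV. (\<mu>' $ j - \<mu> $ j) *
      (((minv (P \<mu>))\<^sup>T *\<^sub>v (Q i *\<^sub>v T.sol b \<mu>')) \<bullet> (Q j *\<^sub>v sol z \<mu>')
       + (minv (P \<mu>) *\<^sub>v (Q i *\<^sub>v sol z \<mu>)) \<bullet> (Q j *\<^sub>v T.sol b \<mu>')))"
    using eventually_det_P[OF d]
  proof eventually_elim
    case (elim \<mu>')
    let ?y = "sol z" and ?w = "T.sol b"
    \<comment> \<open>The mixed term, new dual against old primal solution, is inserted; symmetry of
      \<open>Q i\<close> then leaves in each difference a fixed vector paired with two solutions of
      one pencil.\<close>
    have "?w \<mu>' \<bullet> (Q i *\<^sub>v ?y \<mu>') - ?w \<mu> \<bullet> (Q i *\<^sub>v ?y \<mu>)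
        = ((Q i *\<^sub>v ?w \<mu>') \<bullet> ?y \<mu>' - (Q i *\<^sub>v ?w \<mu>') \<bullet> ?y \<mu>)
        + ((Q i *\<^sub>v ?y \<mu>) \<bullet> ?w \<mu>' - (Q i *\<^sub>v ?y \<mu>) \<bullet> ?w \<mu>)"
      by (simp add: Q_swap[symmetric] sol_carrier T.sol_carrier
          comm_scalar_prod[OF Q_sol_carrier T.sol_carrier])
    also have "(Q i *\<^sub>v ?w \<mu>') \<bullet> ?y \<mu>' - (Q i *\<^sub>v ?w \<mu>') \<bullet> ?y \<mu>
        = (\<Sum>j\<in>UNIV. (\<mu>' $ j - \<mu> $ j) *
          (((minv (P \<mu>))\<^sup>T *\<^sub>v (Q i *\<^sub>v ?w \<mu>')) \<bullet> (Q j *\<^sub>v ?y \<mu>')))"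
      by (rule scalar_prod_sol_diff[OF d elim z T.Q_sol_carrier])
    also have "(Q i *\<^sub>v ?y \<mu>) \<bullet> ?w \<mu>' - (Q i *\<^sub>v ?y \<mu>) \<bullet> ?w \<mu>
        = (\<Sum>j\<in>UNIV. (\<mu>' $ j - \<mu> $ j) *
          ((minv (P \<mu>) *\<^sub>v (Q i *\<^sub>v ?y \<mu>)) \<bullet> (Q j *\<^sub>v ?w \<mu>')))"
      using T.scalar_prod_sol_diff[of \<mu> \<mu>' b "Q i *\<^sub>v ?y \<mu>"]
      by (simp add: dT d elim b Q_sol_carrier minv_transpose[OF P d])
    finally show ?case by (simp add: sum.distrib[symmetric] algebra_simps)
  qed
  show "isCont (\<lambda>\<mu>'. ((minv (P \<mu>))\<^sup>T *\<^sub>v (Q i *\<^sub>v T.sol b \<mu>')) \<bullet> (Q j *\<^sub>v sol z \<mu>')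
       + (minv (P \<mu>) *\<^sub>v (Q i *\<^sub>v sol z \<mu>)) \<bullet> (Q j *\<^sub>v T.sol b \<mu>')) \<mu>" for j
    using inv
    by (intro continuous_add isCont_scalar_prod[OF Q_sol_carrier] isCont_scalar_prod[OF T.Q_sol_carrier]
        isCont_mult_mat_vec[of _ m m] isCont_Q_sol T.isCont_Q_sol T.Q_sol_carrier continuous_const)
      (simp_all add: dT d z b)
qed

end

section \<open>The damped system\<close>

lemma U_mat_carrier:
  "\<Phi> \<in> carrier_mat n n \<Longrightarrow> U_mat n \<Phi> E \<in> carrier_mat (2 * n) (dim_col E)"
  unfolding U_mat_def mult_2 by (rule carrier_append_rows) auto

lemma U_mat_index:
  assumes "\<Phi> \<in> carrier_mat n n" "E \<in> carrier_mat n k" "a < 2 * n" "c < k"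
  shows "U_mat n \<Phi> E $$ (a, c) = (if a < n then 0 else (\<Phi>\<^sup>T * E) $$ (a - n, c))"
  using assms by (auto simp: U_mat_def append_rows_def)

text \<open>The upper block of \<open>U_mat\<close> is zero, so its Gram product lives in the lower
  right block, where regrouping the factors gives the congruence by \<Phi>.\<close>

lemma U_mat_gram_index:
  assumes Phi: "\<Phi> \<in> carrier_mat n n" and E: "E \<in> carrier_mat n k" and ab: "a < 2 * n" "b < 2 * n"
  shows "(U_mat n \<Phi> E * (U_mat n \<Phi> E)\<^sup>T) $$ (a, b)
    = (if a < n \<or> b < n then 0 else (\<Phi>\<^sup>T * (E * E\<^sup>T) * \<Phi>) $$ (a - n, b - n))"
proof -
  have F: "\<Phi>\<^sup>T * E \<in> carrier_mat n k" using Phi E by simp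
  have "\<Phi>\<^sup>T * (E * E\<^sup>T) * \<Phi> = (\<Phi>\<^sup>T * E) * (E\<^sup>T * \<Phi>)"
    using Phi E by (simp add: assoc_mult_mat[of _ n n _ n _ n] assoc_mult_mat[of _ n n _ k _ n]
        assoc_mult_mat[of _ n k _ n _ n])
  also have "E\<^sup>T * \<Phi> = (\<Phi>\<^sup>T * E)\<^sup>T"
    using Phi E by (simp add: transpose_mult[of _ n n _ k])
  finally have "\<Phi>\<^sup>T * (E * E\<^sup>T) * \<Phi> = (\<Phi>\<^sup>T * E) * (\<Phi>\<^sup>T * E)\<^sup>T" .
  moreover have "(U_mat n \<Phi> E * (U_mat n \<Phi> E)\<^sup>T) $$ (a, b)
      = (\<Sum>c<k. U_mat n \<Phi> E $$ (a, c) * U_mat n \<Phi> E $$ (b, c))"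
    using U_mat_carrier[OF Phi, of E] E ab by (auto simp: scalar_prod_def atLeast0LessThan)
  moreover have "\<dots> = (\<Sum>c<k. if a < n \<or> b < n then 0
      else (\<Phi>\<^sup>T * E) $$ (a - n, c) * (\<Phi>\<^sup>T * E) $$ (b - n, c))"
    by (intro sum.cong) (auto simp: U_mat_index[OF Phi E] ab)
  moreover have "((\<Phi>\<^sup>T * E) * (\<Phi>\<^sup>T * E)\<^sup>T) $$ (a - n, b - n)
      = (\<Sum>c<k. (\<Phi>\<^sup>T * E) $$ (a - n, c) * (\<Phi>\<^sup>T * E) $$ (b - n, c))" if "\<not> (a < n \<or> b < n)"
  proof -
    have ab': "a - n < n" "b - n < n" using that ab by auto
    then show ?thesis
      unfolding scalar_prod_def using carrier_matD[OF F]
      by (simp add: scalar_prod_def atLeast0LessThan del: index_mult_mat(1)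
          add: index_mult_mat(1)[of "a - n" "\<Phi>\<^sup>T * E" "b - n" "(\<Phi>\<^sup>T * E)\<^sup>T"])
  qed
  ultimately show ?thesis by (cases "a < n \<or> b < n") (simp_all del: index_mult_mat(1))
qed

text \<open>The double sum makes linearity in the middle matrix visible.\<close>

lemma congruence_index:
  assumes Phi: "\<Phi> \<in> carrier_mat n n" and X: "(X::real mat) \<in> carrier_mat n n" and ab: "a < n" "b < n"
  shows "(\<Phi>\<^sup>T * X * \<Phi>) $$ (a, b) = (\<Sum>l<n. \<Sum>k<n. \<Phi> $$ (l, a) * X $$ (l, k) * \<Phi> $$ (k, b))"
  using assms by (auto simp: scalar_prod_def atLeast0LessThan sum_distrib_left mult.assoc intro!: sum.cong)

lemma damping_carrier: "Dint \<in> carrier_mat n n \<Longrightarrow> damping n Dint D \<mu> \<in> carrier_mat n n"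
  by (simp add: damping_def mat_sum_def)

lemma damping_diff:
  assumes "Dint \<in> carrier_mat n n" and "\<And>i. D i \<in> carrier_mat n (r i)" and "l < n" "k < n"
  shows "damping n Dint D \<mu>' $$ (l, k) = damping n Dint D \<mu> $$ (l, k)
    + (\<Sum>j\<in>UNIV. (\<mu>' $ j - \<mu> $ j) * (D j * (D j)\<^sup>T) $$ (l, k))"
  using assms carrier_matD[OF assms(2)]
  by (simp add: damping_def mat_sum_def left_diff_distrib sum_subtractf del: index_mult_mat(1))

lemma congruence_damping_diff:
  fixes D :: "'k::finite \<Rightarrow> real mat"
  assumes Phi: "\<Phi> \<in> carrier_mat n n" and Dint: "Dint \<in> carrier_mat n n"
    and D: "\<And>i. D i \<in> carrier_mat n (r i)" and ab: "a < n" "b < n"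
  shows "(\<Phi>\<^sup>T * damping n Dint D \<mu>' * \<Phi>) $$ (a, b) = (\<Phi>\<^sup>T * damping n Dint D \<mu> * \<Phi>) $$ (a, b)
    + (\<Sum>j\<in>UNIV. (\<mu>' $ j - \<mu> $ j) * (\<Phi>\<^sup>T * (D j * (D j)\<^sup>T) * \<Phi>) $$ (a, b))"
proof -
  have c: "damping n Dint D \<mu> \<in> carrier_mat n n" for \<mu>
    by (rule damping_carrier[OF Dint])
  have c': "D j * (D j)\<^sup>T \<in> carrier_mat n n" for j using D[of j] by simp
  have "(\<Sum>j\<in>UNIV. (\<mu>' $ j - \<mu> $ j) * (\<Phi>\<^sup>T * (D j * (D j)\<^sup>T) * \<Phi>) $$ (a, b))
      = (\<Sum>l<n. \<Sum>k<n. \<Sum>j\<in>UNIV.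
          (\<mu>' $ j - \<mu> $ j) * (\<Phi> $$ (l, a) * (D j * (D j)\<^sup>T) $$ (l, k) * \<Phi> $$ (k, b)))"
    unfolding congruence_index[OF Phi c' ab] sum_distrib_left
    by (subst sum.swap, rule sum.cong[OF refl], rule sum.swap)
  also have "\<dots> = (\<Sum>l<n. \<Sum>k<n. \<Phi> $$ (l, a)
      * (damping n Dint D \<mu>' $$ (l, k) - damping n Dint D \<mu> $$ (l, k)) * \<Phi> $$ (k, b))"
    using damping_diff[OF Dint D, where \<mu> = \<mu> and \<mu>' = \<mu>']
    by (auto simp: sum_distrib_left sum_distrib_right ac_simps simp del: index_mult_mat(1) intro!: sum.cong)
  also have "\<dots> = (\<Phi>\<^sup>T * damping n Dint D \<mu>' * \<Phi>) $$ (a, b) - (\<Phi>\<^sup>T * damping n Dint D \<mu> * \<Phi>) $$ (a, b)"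
    unfolding congruence_index[OF Phi c ab] sum_subtractf[symmetric] by (simp add: algebra_simps)
  finally show ?thesis by simp
qed

lemma system_mat_carrier:
  assumes "\<Omega> \<in> carrier_mat n n" "\<Phi> \<in> carrier_mat n n" "X \<in> carrier_mat n n"
  shows "system_mat n \<Omega> \<Phi> X \<in> carrier_mat (2 * n) (2 * n)"
  unfolding system_mat_def mult_2 by (rule four_block_carrier_mat) (use assms in auto)

text \<open>The damping occurs only in the lower right block, with a minus sign, and there the
  change matches the Gram products of the \<open>U_mat\<close>.\<close>

lemma system_mat_diff:
  fixes D :: "'k::finite \<Rightarrow> real mat"
  assumes Omega: "\<Omega> \<in> carrier_mat n n" and Phi: "\<Phi> \<in> carrier_mat n n" and Dint: "Dint \<in> carrier_mat n n"
    and D: "\<And>i. D i \<in> carrier_mat n (r i)" and ab: "a < 2 * n" "b < 2 * n"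
  shows "system_mat n \<Omega> \<Phi> (damping n Dint D \<mu>') $$ (a, b) = system_mat n \<Omega> \<Phi> (damping n Dint D \<mu>) $$ (a, b)
    - (\<Sum>j\<in>UNIV. (\<mu>' $ j - \<mu> $ j) * (U_mat n \<Phi> (D j) * (U_mat n \<Phi> (D j))\<^sup>T) $$ (a, b))"
proof -
  have block: "system_mat n \<Omega> \<Phi> X $$ (a, b) =
      (if a < n then if b < n then 0 else \<Omega> $$ (a, b - n)
       else if b < n then - \<Omega> $$ (a - n, b) else - (\<Phi>\<^sup>T * X * \<Phi>) $$ (a - n, b - n))"
    if "X \<in> carrier_mat n n" for X
    using Omega Phi that ab unfolding system_mat_def
    by (subst index_mat_four_block) (auto simp del: index_mult_mat(1))
  show ?thesis
    unfolding block[OF damping_carrier[OF Dint]] U_mat_gram_index[OF Phi D ab]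
    using congruence_damping_diff[OF Phi Dint D, where a = "a - n" and b = "b - n" and \<mu> = \<mu> and \<mu>' = \<mu>'] ab
    by (auto simp del: index_mult_mat(1))
qed

text \<open>The Kronecker sum is linear in its matrix and commutes with transposition, so affine
  dependence and symmetric slopes carry over.\<close>

lemma kronecker_sum_affine_pencil:
  fixes A :: "real ^ 'k::finite \<Rightarrow> real mat"
  assumes A: "\<And>\<mu>. A \<mu> \<in> carrier_mat N N" and S: "\<And>i. S i \<in> carrier_mat N N" "\<And>i. (S i)\<^sup>T = S i"
    and diff: "\<And>\<mu> \<mu>' a b. a < N \<Longrightarrow> b < N \<Longrightarrow>
      A \<mu>' $$ (a, b) = A \<mu> $$ (a, b) - (\<Sum>j\<in>UNIV. (\<mu>' $ j - \<mu> $ j) * S j $$ (a, b))"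
  shows "affine_pencil (N * N) (\<lambda>\<mu>. kronecker_sum N (A \<mu>)) (\<lambda>i. kronecker_sum N (S i))"
proof
  fix \<mu> \<mu>' :: "real ^ 'k" and l k assume lk: "l < N * N" "k < N * N"
  then have "0 < N" by (cases N) auto
  then have lt: "l mod N < N" "k mod N < N" "l div N < N" "k div N < N"
    using lk by (auto simp: less_mult_imp_div_less)
  show "kronecker_sum N (A \<mu>') $$ (l, k) = kronecker_sum N (A \<mu>) $$ (l, k)
      - (\<Sum>j\<in>UNIV. (\<mu>' $ j - \<mu> $ j) * kronecker_sum N (S j) $$ (l, k))"
    unfolding kronecker_sum_index[OF A lk] kronecker_sum_index[OF S(1) lk]
    using diff[OF lt(1,2), of \<mu>' \<mu>] diff[OF lt(3,4), of \<mu>' \<mu>]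
    by (simp add: distrib_left sum.distrib)
qed (use A S in \<open>simp_all add: kronecker_sum_carrier transpose_kronecker_sum\<close>)

text \<open>Stacking is a bijection that turns the equation into a linear system with nonsingular
  matrix; hence the description by \<open>THE\<close> denotes its solution.\<close>

lemma lyapunov_unique_solution:
  assumes A: "A \<in> carrier_mat N N" and d: "det (kronecker_sum N A) \<noteq> 0" and C: "C \<in> carrier_mat N N"
  defines "X \<equiv> THE X. X \<in> carrier_mat N N \<and> A * X + X * A\<^sup>T = - C"
  shows "X \<in> carrier_mat N N" "vec_stack X = minv (kronecker_sum N A) *\<^sub>v (- vec_stack C)"
proof -
  note K = kronecker_sum_carrier[OF A]
  have v: "- vec_stack C \<in> carrier_vec (N * N)" using vec_stack_carrier[OF C] by simp
  let ?x = "minv (kronecker_sum N A) *\<^sub>v (- vec_stack C)"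
  have iff: "A * Y + Y * A\<^sup>T = - C \<longleftrightarrow> vec_stack Y = ?x" if Y: "Y \<in> carrier_mat N N" for Y
  proof
    assume "A * Y + Y * A\<^sup>T = - C"
    then have "kronecker_sum N A *\<^sub>v vec_stack Y = - vec_stack C"
      by (simp add: kronecker_sum_mult_vec_stack[OF A Y] vec_stack_uminus)
    then show "vec_stack Y = ?x"
      by (rule minv_mult_vec_unique[OF K d vec_stack_carrier[OF Y]])
  next
    assume "vec_stack Y = ?x"
    then have "kronecker_sum N A *\<^sub>v vec_stack Y = - vec_stack C"
      by (simp add: mult_minv_vec[OF K d v])
    then have "vec_stack (A * Y + Y * A\<^sup>T) = vec_stack (- C)"
      by (simp add: kronecker_sum_mult_vec_stack[OF A Y] vec_stack_uminus)
    then show "A * Y + Y * A\<^sup>T = - C"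
      using A Y C by (intro vec_stack_inj[of _ N N]) auto
  qed
  have "?x \<in> carrier_vec (N * N)"
    using minv_inverse(1)[OF K d] v by (rule mult_mat_vec_carrier)
  then obtain Y where Y: "Y \<in> carrier_mat N N" "vec_stack Y = ?x" by (rule vec_stack_surj)
  have "\<exists>!X. X \<in> carrier_mat N N \<and> A * X + X * A\<^sup>T = - C"
    using Y iff vec_stack_inj by (metis (no_types, lifting))
  from theI'[OF this] have "X \<in> carrier_mat N N \<and> A * X + X * A\<^sup>T = - C" unfolding X_def .
  then show "X \<in> carrier_mat N N" "vec_stack X = ?x" using iff by auto
qed

text \<open>The trace is the Frobenius product with the identity, which makes the objective a linear
  functional of the stacked solution.\<close>

lemma trace_vec_stack: "Y \<in> carrier_mat N N \<Longrightarrow> trace Y = vec_stack (1\<^sub>m N) \<bullet> vec_stack Y"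
  by (simp add: scalar_prod_vec_stack[of _ N N])

text \<open>Used to read the entries of the Hessian as bilinear forms in the rows of its outer
  factors.\<close>

lemma mult_transpose_index:
  fixes X B Y :: "real mat"
  assumes "X \<in> carrier_mat k m" "B \<in> carrier_mat m m" "Y \<in> carrier_mat l m" "a < k" "b < l"
  shows "(X * B * Y\<^sup>T) $$ (a, b) = row X a \<bullet> (B *\<^sub>v row Y b)"
proof -
  have "X * B * Y\<^sup>T = X * (B * Y\<^sup>T)" using assms by (simp add: assoc_mult_mat[of _ k m _ m _ l])
  then show ?thesis using assms by (simp add: col_mult2[of _ m m _ l] mult_mat_vec_def)
qed

lemma has_derivative_vec_componentwise:
  fixes g :: "'a::real_normed_vector \<Rightarrow> real ^ 'k::finite"
  assumes "\<And>i. ((\<lambda>x. g x $ i) has_derivative (\<lambda>h. g' h $ i)) (at x within X)"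
  shows "(g has_derivative g') (at x within X)"
  unfolding has_derivative_componentwise_within[of g]
proof
  fix b :: "real ^ 'k" assume "b \<in> Basis"
  then obtain i where "b = axis i 1" by (auto simp: Basis_vec_def)
  then show "((\<lambda>x. inner (g x) b) has_derivative (\<lambda>h. inner (g' h) b)) (at x within X)"
    using assms[of i] by (simp add: inner_axis)
qed

lemma has_hessian_componentwise:
  fixes g :: "real ^ 'k::finite \<Rightarrow> real ^ 'k"
  assumes "\<forall>\<^sub>F y in nhds x. GDERIV f y :> g y"
    and "\<And>i. ((\<lambda>y. g y $ i) has_derivative (\<lambda>h. \<Sum>j\<in>UNIV. h $ j * H $ i $ j)) (at x)"
  shows "has_hessian f H x"
proof -
  have "(g has_derivative (\<lambda>h. H *v h)) (at x)"
    using assms(2) by (intro has_derivative_vec_componentwise) (simp add: matrix_vector_mult_def mult.commute)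
  then show ?thesis using assms(1) unfolding has_hessian_def by blast
qed

theorem theorem4:
  fixes n s :: nat
    and r :: "'k::finite \<Rightarrow> nat"
    and M K Dint \<Phi> \<Omega> :: "real mat"
    and \<omega> :: "nat \<Rightarrow> real"
    and D U :: "'k \<Rightarrow> real mat"
    and A Y W :: "real ^ 'k \<Rightarrow> real mat"
    and f :: "real ^ 'k \<Rightarrow> real"
    and \<M> \<N> \<P> :: "real ^ 'k \<Rightarrow> real mat"
    and \<nu> :: "real ^ 'k"
    and idx :: "'k \<Rightarrow> nat"
  assumes M: "M \<in> carrier_mat n n" "pos_def M"
    and K: "K \<in> carrier_mat n n" "pos_def K"
    and Dint: "Dint \<in> carrier_mat n n" "pos_semidef Dint"
    and comm: "Dint * minv M * K = K * minv M * Dint"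
    and D: "\<And>i. D i \<in> carrier_mat n (r i)" "\<And>i. full_rank (D i)"
    and Phi: "\<Phi> \<in> carrier_mat n n" "invertible_mat \<Phi>"
    and Omega: "\<Omega> = mat_diag n \<omega>" "\<And>j. j < n \<Longrightarrow> 0 < \<omega> j"
    and Phi_M: "\<Phi>\<^sup>T * M * \<Phi> = 1\<^sub>m n"
    and Phi_K: "\<Phi>\<^sup>T * K * \<Phi> = \<Omega> ^\<^sub>m 2"
    and Phi_Dint: "diagonal_mat (\<Phi>\<^sup>T * Dint * \<Phi>)"
    and s: "1 \<le> s" "s \<le> n"
    and idx: "bij_betw idx UNIV {..<CARD('k)}"
    and A: "\<And>\<mu>. A \<mu> = system_mat n \<Omega> \<Phi> (damping n Dint D \<mu>)"
    and U: "\<And>i. U i = U_mat n \<Phi> (D i)"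
    and Y: "\<And>\<mu>. Y \<mu> = lyap_Y (A \<mu>) (Z_mat n s)"
    and W: "\<And>\<mu>. W \<mu> = lyap_W (A \<mu>)"
    and f: "\<And>\<mu>. f \<mu> = trace (Y \<mu>)"
    and P: "\<And>\<mu>. \<P> \<mu> = P_mat n (A \<mu>)"
    and MM: "\<And>\<mu>. \<M> \<mu> = M_mat n idx U (Y \<mu>)"
    and NN: "\<And>\<mu>. \<N> \<mu> = N_mat n idx U (W \<mu>)"
    and stable: "stable (A \<nu>)"
  shows "GDERIV f \<nu> :> - U_map U (Y \<nu>) (W \<nu>)
     \<and> has_hessian f
          (to_square idx (- (\<M> \<nu> * (minv (\<P> \<nu>))\<^sup>T * (\<N> \<nu>)\<^sup>T + \<N> \<nu> * minv (\<P> \<nu>) * (\<M> \<nu>)\<^sup>T)))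
          \<nu>"
proof -

  \<comment> \<open>The vectorised system as an affine pencil\<close>
  define N where "N = 2 * n"
  have NN4: "4 * n\<^sup>2 = N * N" by (simp add: N_def power2_eq_square)
  define S where "S i = U i * (U i)\<^sup>T" for i
  define Q where "Q i = kronecker_sum N (S i)" for i
  have Om: "\<Omega> \<in> carrier_mat n n" by (simp add: Omega(1) mat_diag_def)
  have A_carrier: "A \<mu> \<in> carrier_mat N N" for \<mu>
    unfolding A N_def by (rule system_mat_carrier[OF Om Phi(1) damping_carrier[OF Dint(1)]])
  have P_eq: "\<P> \<mu> = kronecker_sum N (A \<mu>)" for \<mu>
    by (simp add: P P_mat_def kronecker_sum_def N_def)
  have U_carrier: "U i \<in> carrier_mat N (dim_col (D i))" for i
    unfolding U N_def by (rule U_mat_carrier[OF Phi(1)])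
  have S_carrier: "S i \<in> carrier_mat N N" for i
    using U_carrier[of i] by (simp add: S_def)
  have S_sym: "(S i)\<^sup>T = S i" for i
    using U_carrier[of i] by (simp add: S_def transpose_mult[of _ N "dim_col (D i)" _ N])
  have Z_carrier: "Z_mat n s \<in> carrier_mat N N"
  proof -
    have "1\<^sub>m s @\<^sub>r 0\<^sub>m (n - s) s \<in> carrier_mat (s + (n - s)) s"
      by (rule carrier_append_rows) auto
    \<comment> \<open>Subtraction of naturals truncates, so \<open>s + (n - s) = n\<close> rests on
      \<open>s \<le> n\<close>.\<close>
    then have "1\<^sub>m s @\<^sub>r 0\<^sub>m (n - s) s \<in> carrier_mat n s" using s(2) by simp
    then have "G_mat n s \<in> carrier_mat (n + n) (s + s)"
      unfolding G_mat_def by (intro four_block_carrier_mat) auto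
    then have "G_mat n s * (G_mat n s)\<^sup>T \<in> carrier_mat N N"
      unfolding N_def mult_2 by (intro mult_carrier_mat[of _ _ "s + s"] transpose_carrier_mat[THEN iffD2])
    then show ?thesis unfolding Z_mat_def by (rule smult_carrier_mat)
  qed
  \<comment> \<open>\<open>z\<close> absorbs the minus sign of the primal equation. \<open>e\<close>
    keeps the plus sign so that \<open>f\<close> is \<open>e\<close> paired with the solution; the
    dual right-hand side is therefore \<open>- e\<close>.\<close>
  define z e where "z = - vec_stack (Z_mat n s)" and "e = vec_stack (1\<^sub>m N :: real mat)"
  have z: "z \<in> carrier_vec (N * N)" using vec_stack_carrier[OF Z_carrier] by (simp add: z_def)
  have e: "e \<in> carrier_vec (N * N)" using vec_stack_carrier[of "1\<^sub>m N" N N] by (simp add: e_def)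
  interpret L: affine_pencil "N * N" \<P> Q
    unfolding P_eq Q_def
  proof (rule kronecker_sum_affine_pencil[OF A_carrier S_carrier S_sym])
    fix \<mu> \<mu>' :: "real ^ 'k" and a b assume "a < N" "b < N"
    then show "A \<mu>' $$ (a, b) = A \<mu> $$ (a, b) - (\<Sum>j\<in>UNIV. (\<mu>' $ j - \<mu> $ j) * S j $$ (a, b))"
      unfolding A S_def U N_def by (intro system_mat_diff[OF Om Phi(1) Dint(1) D(1)])
  qed
  interpret LT: affine_pencil "N * N" "\<lambda>\<mu>. (\<P> \<mu>)\<^sup>T" Q by (rule L.affine_pencil_transpose)
  have det_transp: "det (\<P> \<mu>)\<^sup>T = det (\<P> \<mu>)" for \<mu> by (rule det_transpose[OF L.P])
  \<comment> \<open>The identification is made at every nonsingular point, not only at \<nu>,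
    because the Hessian needs the gradient on a whole neighbourhood.\<close>
  have Yv: "Y \<mu> \<in> carrier_mat N N" "vec_stack (Y \<mu>) = L.sol z \<mu>" if d: "det (\<P> \<mu>) \<noteq> 0" for \<mu>
  proof -
    have "Y \<mu> = (THE X. X \<in> carrier_mat N N \<and> A \<mu> * X + X * (A \<mu>)\<^sup>T = - Z_mat n s)"
      unfolding Y lyap_Y_def carrier_matD(1)[OF A_carrier] ..
    moreover have "L.sol z \<mu> = minv (\<P> \<mu>) *\<^sub>v z"
      unfolding L.sol_def minv_eq_adj_inverse[OF L.P d] ..
    ultimately show "Y \<mu> \<in> carrier_mat N N" "vec_stack (Y \<mu>) = L.sol z \<mu>"
      using lyapunov_unique_solution[OF A_carrier d[unfolded P_eq] Z_carrier]
      unfolding P_eq z_def by metis+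
  qed
  have Wv: "W \<mu> \<in> carrier_mat N N" "vec_stack (W \<mu>) = LT.sol (- e) \<mu>" if d: "det (\<P> \<mu>) \<noteq> 0" for \<mu>
  proof -
    have At: "(A \<mu>)\<^sup>T \<in> carrier_mat N N" using A_carrier[of \<mu>] by simp
    have Pt: "kronecker_sum N (A \<mu>)\<^sup>T = (\<P> \<mu>)\<^sup>T"
      by (simp add: P_eq transpose_kronecker_sum[OF A_carrier])
    have d': "det (\<P> \<mu>)\<^sup>T \<noteq> 0" using d by (simp add: det_transp)
    \<comment> \<open>Writing \<open>A \<mu>\<close> as a double transpose gives the dual equation
      the primal form for the transposed matrix.\<close>
    have "W \<mu> = (THE X. X \<in> carrier_mat N N \<and> (A \<mu>)\<^sup>T * X + X * ((A \<mu>)\<^sup>T)\<^sup>T = - 1\<^sub>m N)"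
      unfolding W lyap_W_def carrier_matD(1)[OF A_carrier] transpose_transpose ..
    moreover have "LT.sol (- e) \<mu> = minv (\<P> \<mu>)\<^sup>T *\<^sub>v (- e)"
      unfolding LT.sol_def minv_eq_adj_inverse[OF LT.P d'] ..
    ultimately show "W \<mu> \<in> carrier_mat N N" "vec_stack (W \<mu>) = LT.sol (- e) \<mu>"
      using lyapunov_unique_solution[OF At, unfolded Pt, OF d' one_carrier_mat]
      unfolding e_def by metis+
  qed
  \<comment> \<open>Symmetry of \<open>S i\<close> removes the transpose, so the matrices stacked in
    the rows of \<open>\<M>\<close> and \<open>\<N>\<close> are images under
    \<open>Q i\<close>.\<close>
  have Q_vec: "Q i *\<^sub>v vec_stack X = vec_stack (S i * X + X * S i)" if "X \<in> carrier_mat N N" for i X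
    using kronecker_sum_mult_vec_stack[OF S_carrier that, of i] by (simp add: Q_def S_sym)
  have U_map_eq: "U_map U (Y \<mu>) (W \<mu>) $ i = LT.sol (- e) \<mu> \<bullet> (Q i *\<^sub>v L.sol z \<mu>)"
    if d: "det (\<P> \<mu>) \<noteq> 0" for \<mu> i
  proof -
    have "S i * Y \<mu> + Y \<mu> * S i \<in> carrier_mat N N" using S_carrier[of i] Yv(1)[OF d] by simp
    then show ?thesis
      unfolding Yv(2)[OF d, symmetric] Wv(2)[OF d, symmetric] Q_vec[OF Yv(1)[OF d]]
      by (simp add: scalar_prod_vec_stack[OF Wv(1)[OF d]] U_map_def S_def)
  qed

  \<comment> \<open>The gradient at every nonsingular point\<close>
  have f_eq: "f \<mu> = e \<bullet> L.sol z \<mu>" if d: "det (\<P> \<mu>) \<noteq> 0" for \<mu>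
    using trace_vec_stack[OF Yv(1)[OF d]] by (simp add: f e_def Yv(2)[OF d])
  have gradient: "GDERIV f \<mu> :> - U_map U (Y \<mu>) (W \<mu>)" if d: "det (\<P> \<mu>) \<noteq> 0" for \<mu>
  proof -
    have inv: "minv (\<P> \<mu>) \<in> carrier_mat (N * N) (N * N)" by (rule minv_inverse[OF L.P d])
    have d': "det (\<P> \<mu>)\<^sup>T \<noteq> 0" using d by (simp add: det_transp)
    have "LT.sol (- e) \<mu> = - ((minv (\<P> \<mu>))\<^sup>T *\<^sub>v e)"
      using mult_mat_vec_uminus[OF transpose_carrier_mat[THEN iffD2, OF inv] e]
      by (simp add: LT.sol_def minv_eq_adj_inverse[OF LT.P d', symmetric] minv_transpose[OF L.P d])
    then have w: "(minv (\<P> \<mu>))\<^sup>T *\<^sub>v e = - LT.sol (- e) \<mu>" by simp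
    have "((\<lambda>\<mu>. e \<bullet> L.sol z \<mu>) has_derivative
        (\<lambda>h. \<Sum>j\<in>UNIV. h $ j * (- LT.sol (- e) \<mu> \<bullet> (Q j *\<^sub>v L.sol z \<mu>)))) (at \<mu>)"
      using L.has_derivative_scalar_prod_sol[OF d z e] unfolding w .
    also have "(\<lambda>h. \<Sum>j\<in>UNIV. h $ j * (- LT.sol (- e) \<mu> \<bullet> (Q j *\<^sub>v L.sol z \<mu>)))
        = (\<lambda>h. inner h (- U_map U (Y \<mu>) (W \<mu>)))"
      using carrier_vecD[OF LT.sol_carrier[of "- e" \<mu>]] carrier_vecD[OF L.Q_sol_carrier[of _ z \<mu>]]
      by (simp add: inner_vec_def U_map_eq[OF d] scalar_prod_uminus_left)
    finally have der: "((\<lambda>\<mu>. e \<bullet> L.sol z \<mu>) has_derivative (\<lambda>h. inner h (- U_map U (Y \<mu>) (W \<mu>)))) (at \<mu>)" .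
    \<comment> \<open>\<open>f\<close> and the linear functional of \<open>sol\<close> are
      identified only where the pencil is nonsingular, so the derivative is transferred along
      eventual equality.\<close>
    have ev: "\<forall>\<^sub>F \<mu>' in at \<mu>. e \<bullet> L.sol z \<mu>' = f \<mu>'"
      using L.eventually_det_P[OF d] unfolding eventually_nhds_conv_at
      by (auto elim!: eventually_mono simp: f_eq)
    show ?thesis
      unfolding gderiv_def
      by (rule has_derivative_transform_eventually[OF der ev]) (simp_all add: f_eq[OF d])
  qed
  \<comment> \<open>Stability enters as nonsingularity at \<nu>, which persists nearby.\<close>
  have d: "det (\<P> \<nu>) \<noteq> 0"
    unfolding P_eq by (rule stable_det_kronecker_sum[OF A_carrier stable])

  \<comment> \<open>Entries of the Hessian matrix\<close>
  define H where "H = to_square idx (- (\<M> \<nu> * (minv (\<P> \<nu>))\<^sup>T * (\<N> \<nu>)\<^sup>T + \<N> \<nu> * minv (\<P> \<nu>) * (\<M> \<nu>)\<^sup>T))"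
  have inv: "minv (\<P> \<nu>) \<in> carrier_mat (N * N) (N * N)" by (rule minv_inverse[OF L.P d])
  have idx_less: "idx i < CARD('k)" for i using bij_betwE[OF idx] by auto
  have inv_idx: "inv_into UNIV idx (idx i) = i" for i
    using bij_betw_imp_inj_on[OF idx] by simp
  have M_carrier: "\<M> \<nu> \<in> carrier_mat CARD('k) (N * N)" and N_carrier: "\<N> \<nu> \<in> carrier_mat CARD('k) (N * N)"
    by (simp_all add: MM NN M_mat_def N_mat_def NN4)
  have row_M: "row (\<M> \<nu>) (idx i) = Q i *\<^sub>v L.sol z \<nu>" for i
  proof -
    have "row (\<M> \<nu>) (idx i) = vec_stack (S i * Y \<nu> + Y \<nu> * S i)"
      using carrier_matD[OF S_carrier[of i]] carrier_matD[OF Yv(1)[OF d]]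
      by (simp add: MM M_mat_def NN4 idx_less inv_idx S_def)
    then show ?thesis by (simp add: Q_vec[OF Yv(1)[OF d], symmetric] Yv(2)[OF d])
  qed
  have row_N: "row (\<N> \<nu>) (idx i) = Q i *\<^sub>v LT.sol (- e) \<nu>" for i
  proof -
    have "row (\<N> \<nu>) (idx i) = vec_stack (W \<nu> * S i + S i * W \<nu>)"
      using carrier_matD[OF S_carrier[of i]] carrier_matD[OF Wv(1)[OF d]]
      by (simp add: NN N_mat_def NN4 idx_less inv_idx S_def)
    also have "W \<nu> * S i + S i * W \<nu> = S i * W \<nu> + W \<nu> * S i"
      using S_carrier[of i] Wv(1)[OF d] by (intro comm_add_mat[of _ N N]) auto
    finally show ?thesis by (simp add: Q_vec[OF Wv(1)[OF d], symmetric] Wv(2)[OF d])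
  qed
  \<comment> \<open>The right-hand side has the shape delivered by the product rule. Moving the
    inverse across the scalar product shows that the term starting with \<open>\<M>\<close> yields
    its second summand and the term starting with \<open>\<N>\<close> its first.\<close>
  have H_entry: "H $ i $ j = - (((minv (\<P> \<nu>))\<^sup>T *\<^sub>v (Q i *\<^sub>v LT.sol (- e) \<nu>)) \<bullet> (Q j *\<^sub>v L.sol z \<nu>)
       + (minv (\<P> \<nu>) *\<^sub>v (Q i *\<^sub>v L.sol z \<nu>)) \<bullet> (Q j *\<^sub>v LT.sol (- e) \<nu>))" for i j
  proof -
    let ?m = "\<lambda>i. Q i *\<^sub>v L.sol z \<nu>" and ?n = "\<lambda>i. Q i *\<^sub>v LT.sol (- e) \<nu>"
    have invT: "(minv (\<P> \<nu>))\<^sup>T \<in> carrier_mat (N * N) (N * N)" using inv by simp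
    have "H $ i $ j = - ((\<M> \<nu> * (minv (\<P> \<nu>))\<^sup>T * (\<N> \<nu>)\<^sup>T) $$ (idx i, idx j)
        + (\<N> \<nu> * minv (\<P> \<nu>) * (\<M> \<nu>)\<^sup>T) $$ (idx i, idx j))"
      using M_carrier N_carrier inv idx_less
      by (simp add: H_def to_square_def del: index_mult_mat(1))
    also have "(\<M> \<nu> * (minv (\<P> \<nu>))\<^sup>T * (\<N> \<nu>)\<^sup>T) $$ (idx i, idx j) = ?m i \<bullet> ((minv (\<P> \<nu>))\<^sup>T *\<^sub>v ?n j)"
      by (simp only: mult_transpose_index[OF M_carrier invT N_carrier idx_less idx_less] row_M row_N)
    also have "\<dots> = (minv (\<P> \<nu>) *\<^sub>v ?m i) \<bullet> ?n j"
      using scalar_prod_transpose_mult[OF invT L.Q_sol_carrier LT.Q_sol_carrier] by simp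
    also have "(\<N> \<nu> * minv (\<P> \<nu>) * (\<M> \<nu>)\<^sup>T) $$ (idx i, idx j) = ?n i \<bullet> (minv (\<P> \<nu>) *\<^sub>v ?m j)"
      by (simp only: mult_transpose_index[OF N_carrier inv M_carrier idx_less idx_less] row_M row_N)
    also have "\<dots> = ((minv (\<P> \<nu>))\<^sup>T *\<^sub>v ?n i) \<bullet> ?m j"
      by (rule scalar_prod_transpose_mult[OF inv LT.Q_sol_carrier L.Q_sol_carrier, symmetric])
    finally show ?thesis by (simp add: add.commute)
  qed

  \<comment> \<open>Differentiation of the gradient\<close>
  have "has_hessian f H \<nu>"
  proof (rule has_hessian_componentwise)
    show "\<forall>\<^sub>F \<mu> in nhds \<nu>. GDERIV f \<mu> :> (- U_map U (Y \<mu>) (W \<mu>))"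
      using L.eventually_det_P[OF d] by eventually_elim (rule gradient)
    fix i
    \<comment> \<open>The product rule has coefficients \<open>- H $ i $ j\<close>, and the minus
      sign of the gradient cancels theirs.\<close>
    have "((\<lambda>\<mu>. - (LT.sol (- e) \<mu> \<bullet> (Q i *\<^sub>v L.sol z \<mu>))) has_derivative
        (\<lambda>h. - (\<Sum>j\<in>UNIV. h $ j * - H $ i $ j))) (at \<nu>)"
      using L.has_derivative_dual_sol_Q_sol[OF d z, of "- e" i] e
      by (intro has_derivative_minus) (simp add: H_entry add.commute)
    then have der: "((\<lambda>\<mu>. - (LT.sol (- e) \<mu> \<bullet> (Q i *\<^sub>v L.sol z \<mu>))) has_derivative
        (\<lambda>h. \<Sum>j\<in>UNIV. h $ j * H $ i $ j)) (at \<nu>)"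
      by (simp add: sum_negf)
    have ev: "\<forall>\<^sub>F \<mu> in at \<nu>. - (LT.sol (- e) \<mu> \<bullet> (Q i *\<^sub>v L.sol z \<mu>)) = (- U_map U (Y \<mu>) (W \<mu>)) $ i"
      using L.eventually_det_P[OF d] unfolding eventually_nhds_conv_at
      by (auto elim!: eventually_mono simp: U_map_eq)
    show "((\<lambda>\<mu>. (- U_map U (Y \<mu>) (W \<mu>)) $ i) has_derivative (\<lambda>h. \<Sum>j\<in>UNIV. h $ j * H $ i $ j)) (at \<nu>)"
      by (rule has_derivative_transform_eventually[OF der ev]) (simp_all add: U_map_eq[OF d])
  qed
  with gradient[OF d] show ?thesis unfolding H_def by blast
qed

end
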